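(* Let $E$ be a Dedekind complete vector lattice, and let each of $c_1,c_2,c_3$ be either unbounded order convergence (uo) in $\mathcal{L}_{\mathrm{ob}}(E)$ or strong unbounded order convergence (SUO) in $\mathcal{L}_{\mathrm{ob}}(E)$ (all eight combinations are allowed). Suppose that $(S_\alpha)_{\alpha\in A}$ is a net in $\mathrm{Orth}(E)$ such that $S_\alpha\xrightarrow{c_1}S$ for some $S\in\mathcal{L}_{\mathrm{ob}}(E)$, and that $(T_\beta)_{\beta\in B}$ is a net in $\mathrm{Orth}(E)$ such that $T_\beta\xrightarrow{c_2}T$ for some $T\in\mathcal{L}_{\mathrm{ob}}(E)$. Then $S,T\in\mathrm{Orth}(E)$, and $S_\alpha T_\beta\xrightarrow{c_3}ST$.
   Context: All vector lattices are real and Archimedean. $\mathcal{L}_{\mathrm{ob}}(E)$ is the space of order bounded linear operators on $E$, a Dedekind complete vector lattice in the operator order when $E$ is Dedekind complete; $\mathrm{Orth}(E)$ is the set of orthomorphisms on $E$, i.e. of order bounded linear operators $T:E\to E$ with $T(B)\subseteq B$ for every band $B$ of $E$. In a vector lattice $G$, a net $(x_\alpha)_{\alpha\in A}$ is order convergent to $x$ ($x_\alpha\xrightarrow{\mathrm{o}}x$) if there is a net $(y_\beta)_{\beta\in B}$ in $G$ with $y_\beta\downarrow 0$ such that for every $\beta_0\in B$ there is $\alpha_0\in A$ with $|x-x_\alpha|\le y_{\beta_0}$ for all $\alpha\ge\alpha_0$; it is unbounded order convergent to $x$ ($x_\alpha\xrightarrow{\mathrm{uo}}x$) if $|x_\alpha-x|\wedge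 y\xrightarrow{\mathrm{o}}0$ in $G$ for all $y\in G^+$. Strong unbounded order convergence $T_\alpha\xrightarrow{\mathrm{SUO}}T$ in $\mathcal{L}_{\mathrm{ob}}(E)$ means $T_\alpha x\xrightarrow{\mathrm{uo}}Tx$ in $E$ for all $x\in E$. The net $(S_\alpha T_\beta)$ is indexed by $A\times B$ with the product order. *)

theory Defs
  imports Complex_Main "HOL-Library.Lattice_Algebras" "HOL-Library.Lub_Glb"
begin

section \<open>Vector lattices\<close>

class vector_lattice = ordered_real_vector + lattice_ab_group_add_abs

text \<open>
  \<^class>\<open>conditionally_complete_lattice\<close> asks for suprema of nonempty sets that are bounded above and
  infima of nonempty sets that are bounded below, which is Dedekind completeness.  The Archimedean
  property is then automatic, see \<open>dedekind_complete_archimedean\<close> below.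
\<close>

class dedekind_complete_vector_lattice = vector_lattice + conditionally_complete_lattice

lemma dedekind_complete_archimedean:
  fixes x y :: "'a::dedekind_complete_vector_lattice"
  assumes "\<And>n::nat. real n *\<^sub>R x \<le> y"
  shows "x \<le> 0"
proof -
  let ?D = "range (\<lambda>n::nat. real n *\<^sub>R x)"
  have bdd: "bdd_above ?D" using assms by (auto simp: bdd_above_def)
  have "real n *\<^sub>R x \<le> Sup ?D - x" for n
  proof -
    have "real (Suc n) *\<^sub>R x \<le> Sup ?D" by (rule cSup_upper[OF _ bdd]) blast
    then show ?thesis by (simp add: algebra_simps)
  qed
  then have "Sup ?D \<le> Sup ?D - x" by (intro cSup_least) auto
  then show ?thesis by simp
qed

definition order_bounded :: "'a::order set \<Rightarrow> bool" where
  "order_bounded A \<longleftrightarrow> (\<exists>a b. A \<subseteq> {a..b})"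

definition ideal :: "'a::vector_lattice set \<Rightarrow> bool" where
  "ideal B \<longleftrightarrow> subspace B \<and> (\<forall>x y. y \<in> B \<longrightarrow> \<bar>x\<bar> \<le> \<bar>y\<bar> \<longrightarrow> x \<in> B)"

definition band :: "'a::vector_lattice set \<Rightarrow> bool" where
  "band B \<longleftrightarrow> ideal B \<and> (\<forall>D x. D \<subseteq> B \<longrightarrow> isLub UNIV D x \<longrightarrow> x \<in> B)"


section \<open>Nets, order convergence and unbounded order convergence\<close>

text \<open>
  A net is a function together with an index set \<open>A\<close> and a directed preorder \<open>r\<close> on \<open>A\<close>, where
  \<open>(a, a') \<in> r\<close> means that \<open>a'\<close> comes after \<open>a\<close>.
\<close>

definition directed_on :: "'i set \<Rightarrow> 'i rel \<Rightarrow> bool" where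
  "directed_on A r \<longleftrightarrow>
     A \<noteq> {} \<and> preorder_on A r \<and> (\<forall>a\<in>A. \<forall>b\<in>A. \<exists>c\<in>A. (a, c) \<in> r \<and> (b, c) \<in> r)"

definition product_order :: "'i rel \<Rightarrow> 'j rel \<Rightarrow> ('i \<times> 'j) rel" where
  "product_order r s = {((a, b), (a', b')). (a, a') \<in> r \<and> (b, b') \<in> s}"

lemma directed_on_product_order:
  assumes "directed_on A r" "directed_on B s"
  shows "directed_on (A \<times> B) (product_order r s)"
  unfolding directed_on_def
proof (intro conjI ballI)
  show "A \<times> B \<noteq> {}" using assms by (simp add: directed_on_def)
  have r: "r \<subseteq> A \<times> A" "refl_on A r" "trans r" and s: "s \<subseteq> B \<times> B" "refl_on B s" "trans s"
    using assms by (simp_all add: directed_on_def preorder_on_def)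
  have "product_order r s \<subseteq> (A \<times> B) \<times> (A \<times> B)"
    using r(1) s(1) by (auto simp: product_order_def)
  moreover have "refl_on (A \<times> B) (product_order r s)"
    using r(2) s(2) by (auto simp: product_order_def refl_on_def)
  moreover have "trans (product_order r s)"
    by (rule transI) (auto simp: product_order_def intro: transD[OF r(3)] transD[OF s(3)])
  ultimately show "preorder_on (A \<times> B) (product_order r s)" by (simp add: preorder_on_def)
  fix p q assume "p \<in> A \<times> B" "q \<in> A \<times> B"
  then obtain a b a' b' where pq: "p = (a, b)" "q = (a', b')" "a \<in> A" "a' \<in> A" "b \<in> B" "b' \<in> B"
    by blast
  obtain c where c: "c \<in> A" "(a, c) \<in> r" "(a', c) \<in> r"
    using assms(1) pq unfolding directed_on_def by meson
  obtain d where d: "d \<in> B" "(b, d) \<in> s" "(b', d) \<in> s"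
    using assms(2) pq unfolding directed_on_def by meson
  show "\<exists>u\<in>A \<times> B. (p, u) \<in> product_order r s \<and> (q, u) \<in> product_order r s"
    using c d pq by (intro bexI[of _ "(c, d)"]) (auto simp: product_order_def)
qed

definition decreases_to_zero :: "'j set \<Rightarrow> 'j rel \<Rightarrow> ('j \<Rightarrow> 'a::vector_lattice) \<Rightarrow> bool" where
  "decreases_to_zero B s y \<longleftrightarrow>
     (\<forall>b b'. (b, b') \<in> s \<longrightarrow> y b' \<le> y b) \<and> isGlb UNIV (y ` B) 0"

text \<open>
  The dominating net \<open>y\<close> may have any directed index set, but HOL cannot quantify existentially over
  types; the index set is therefore taken inside the type of the space itself.  No generality is
  lost: see \<open>order_tendstoI\<close> below.
\<close>

definition order_tendsto ::
    "'i set \<Rightarrow> 'i rel \<Rightarrow> ('i \<Rightarrow> 'a::vector_lattice) \<Rightarrow> 'a \<Rightarrow> bool" where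
  "order_tendsto A r f l \<longleftrightarrow>
     (\<exists>(B :: 'a set) s y. directed_on B s \<and> decreases_to_zero B s y \<and>
        (\<forall>b0\<in>B. \<exists>a0\<in>A. \<forall>a. (a0, a) \<in> r \<longrightarrow> \<bar>l - f a\<bar> \<le> y b0))"

lemma order_tendstoI:
  fixes f :: "'i \<Rightarrow> 'a::vector_lattice" and B :: "'j set"
  assumes dir: "directed_on B s" and dec: "decreases_to_zero B s y"
    and le: "\<And>b0. b0 \<in> B \<Longrightarrow> \<exists>a0\<in>A. \<forall>a. (a0, a) \<in> r \<longrightarrow> \<bar>l - f a\<bar> \<le> y b0"
  shows "order_tendsto A r f l"
proof -
  let ?B = "y ` B"
  let ?s = "{(u, v). u \<in> ?B \<and> v \<in> ?B \<and> v \<le> u}"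
  have "directed_on ?B ?s"
    unfolding directed_on_def
  proof (intro conjI ballI)
    show "?B \<noteq> {}" using dir by (simp add: directed_on_def)
    show "preorder_on ?B ?s"
      by (auto simp: preorder_on_def refl_on_def trans_def)
    fix u v assume "u \<in> ?B" "v \<in> ?B"
    then obtain b c where bc: "b \<in> B" "c \<in> B" "u = y b" "v = y c" by blast
    then obtain d where "d \<in> B" "(b, d) \<in> s" "(c, d) \<in> s"
      using dir unfolding directed_on_def by blast
    then show "\<exists>w\<in>?B. (u, w) \<in> ?s \<and> (v, w) \<in> ?s"
      using dec bc unfolding decreases_to_zero_def by blast
  qed
  moreover have "decreases_to_zero ?B ?s (\<lambda>u. u)"
    using dec by (auto simp: decreases_to_zero_def)
  moreover have "\<forall>b0\<in>?B. \<exists>a0\<in>A. \<forall>a. (a0, a) \<in> r \<longrightarrow> \<bar>l - f a\<bar> \<le> b0"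
    using le by blast
  ultimately show ?thesis unfolding order_tendsto_def by blast
qed

definition uo_tendsto ::
    "'i set \<Rightarrow> 'i rel \<Rightarrow> ('i \<Rightarrow> 'a::vector_lattice) \<Rightarrow> 'a \<Rightarrow> bool" where
  "uo_tendsto A r f l \<longleftrightarrow> (\<forall>y\<ge>0. order_tendsto A r (\<lambda>a. inf \<bar>f a - l\<bar> y) 0)"


section \<open>Order bounded operators\<close>

definition order_bounded_operator :: "('a::vector_lattice \<Rightarrow> 'a) \<Rightarrow> bool" where
  "order_bounded_operator T \<longleftrightarrow> linear T \<and> (\<forall>A. order_bounded A \<longrightarrow> order_bounded (T ` A))"

lemma order_bounded_operatorI:
  "linear T \<Longrightarrow> (\<And>A. order_bounded A \<Longrightarrow> order_bounded (T ` A)) \<Longrightarrow> order_bounded_operator T"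
  by (simp add: order_bounded_operator_def)

lemma order_bounded_operatorD:
  assumes "order_bounded_operator T"
  shows "linear T" "order_bounded A \<Longrightarrow> order_bounded (T ` A)"
  using assms unfolding order_bounded_operator_def by blast+

text \<open>The elements of this type are the elements of $\mathcal{L}_{\mathrm{ob}}(E)$.\<close>

typedef (overloaded) 'a ob_operator = "{T :: 'a::vector_lattice \<Rightarrow> 'a. order_bounded_operator T}"
  morphisms ob_apply Abs_ob_operator
proof
  have "linear (\<lambda>x::'a. x)" by (simp add: linear_iff)
  then show "(\<lambda>x::'a. x) \<in> {T. order_bounded_operator T}"
    by (simp add: order_bounded_operator_def)
qed

setup_lifting type_definition_ob_operator

lemma order_bounded_operator_ob_apply: "order_bounded_operator (ob_apply T)"
  using ob_apply[of T] by simp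

lemmas linear_ob_apply = order_bounded_operatorD(1)[OF order_bounded_operator_ob_apply]
lemmas order_bounded_ob_apply = order_bounded_operatorD(2)[OF order_bounded_operator_ob_apply]

lemma order_bounded_image_iff:
  "order_bounded (f ` A) \<longleftrightarrow> (\<exists>a b. \<forall>x\<in>A. a \<le> f x \<and> f x \<le> b)"
  by (simp add: order_bounded_def image_subset_iff)

lemma order_bounded_plus_image:
  fixes f g :: "'a \<Rightarrow> 'b::ordered_ab_group_add"
  assumes "order_bounded (f ` A)" "order_bounded (g ` A)"
  shows "order_bounded ((\<lambda>x. f x + g x) ` A)"
proof -
  obtain a b where f: "\<forall>x\<in>A. a \<le> f x \<and> f x \<le> b"
    using assms(1) unfolding order_bounded_image_iff by blast
  obtain c d where g: "\<forall>x\<in>A. c \<le> g x \<and> g x \<le> d"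
    using assms(2) unfolding order_bounded_image_iff by blast
  have "\<forall>x\<in>A. a + c \<le> f x + g x \<and> f x + g x \<le> b + d"
    using f g by (simp add: add_mono)
  then show ?thesis unfolding order_bounded_image_iff by blast
qed

lemma order_bounded_uminus_image:
  fixes f :: "'a \<Rightarrow> 'b::ordered_ab_group_add"
  assumes "order_bounded (f ` A)"
  shows "order_bounded ((\<lambda>x. - f x) ` A)"
proof -
  obtain a b where "\<forall>x\<in>A. a \<le> f x \<and> f x \<le> b"
    using assms unfolding order_bounded_image_iff by blast
  then have "\<forall>x\<in>A. - b \<le> - f x \<and> - f x \<le> - a" by simp
  then show ?thesis unfolding order_bounded_image_iff by blast
qed

lemma order_bounded_minus_image:
  fixes f g :: "'a \<Rightarrow> 'b::ordered_ab_group_add"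
  assumes "order_bounded (f ` A)" "order_bounded (g ` A)"
  shows "order_bounded ((\<lambda>x. f x - g x) ` A)"
  using order_bounded_plus_image[OF assms(1) order_bounded_uminus_image[OF assms(2)]] by simp

lemma order_bounded_scaleR_image:
  fixes f :: "'a \<Rightarrow> 'b::ordered_real_vector"
  assumes "order_bounded (f ` A)"
  shows "order_bounded ((\<lambda>x. c *\<^sub>R f x) ` A)"
proof -
  obtain a b where ab: "\<forall>x\<in>A. a \<le> f x \<and> f x \<le> b"
    using assms unfolding order_bounded_image_iff by blast
  show ?thesis
  proof (cases "0 \<le> c")
    case True
    with ab have "\<forall>x\<in>A. c *\<^sub>R a \<le> c *\<^sub>R f x \<and> c *\<^sub>R f x \<le> c *\<^sub>R b"
      by (simp add: scaleR_left_mono)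
    then show ?thesis unfolding order_bounded_image_iff by blast
  next
    case False
    with ab have "\<forall>x\<in>A. c *\<^sub>R b \<le> c *\<^sub>R f x \<and> c *\<^sub>R f x \<le> c *\<^sub>R a"
      by (simp add: scaleR_left_mono_neg)
    then show ?thesis unfolding order_bounded_image_iff by blast
  qed
qed

lift_definition ob_compose ::
    "'a::vector_lattice ob_operator \<Rightarrow> 'a ob_operator \<Rightarrow> 'a ob_operator"
  is "\<lambda>S T x. S (T x)"
proof (rule order_bounded_operatorI)
  fix S T :: "'a \<Rightarrow> 'a"
  assume S: "order_bounded_operator S" and T: "order_bounded_operator T"
  show "linear (\<lambda>x. S (T x))"
    using linear_compose[OF order_bounded_operatorD(1)[OF T] order_bounded_operatorD(1)[OF S]]
    by (simp add: o_def)
  show "order_bounded ((\<lambda>x. S (T x)) ` A)" if "order_bounded A" for A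
    using order_bounded_operatorD(2)[OF S order_bounded_operatorD(2)[OF T that]]
    by (simp add: image_image)
qed

instantiation ob_operator :: (vector_lattice) real_vector
begin

lift_definition zero_ob_operator :: "'a ob_operator" is "\<lambda>_. 0"
proof (rule order_bounded_operatorI)
  show "linear (\<lambda>_::'a. 0::'a)" by (simp add: linear_iff)
  have "(\<lambda>_::'a. 0::'a) ` A \<subseteq> {0..0}" for A by auto
  then show "order_bounded ((\<lambda>_::'a. 0::'a) ` A)" for A unfolding order_bounded_def by blast
qed

lift_definition plus_ob_operator :: "'a ob_operator \<Rightarrow> 'a ob_operator \<Rightarrow> 'a ob_operator"
  is "\<lambda>S T x. S x + T x"
  by (rule order_bounded_operatorI;
      intro linear_compose_add order_bounded_plus_image order_bounded_operatorD)

lift_definition uminus_ob_operator :: "'a ob_operator \<Rightarrow> 'a ob_operator"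
  is "\<lambda>T x. - T x"
  by (rule order_bounded_operatorI;
      intro linear_compose_neg order_bounded_uminus_image order_bounded_operatorD)

lift_definition minus_ob_operator :: "'a ob_operator \<Rightarrow> 'a ob_operator \<Rightarrow> 'a ob_operator"
  is "\<lambda>S T x. S x - T x"
  by (rule order_bounded_operatorI;
      intro linear_compose_sub order_bounded_minus_image order_bounded_operatorD)

lift_definition scaleR_ob_operator :: "real \<Rightarrow> 'a ob_operator \<Rightarrow> 'a ob_operator"
  is "\<lambda>c T x. c *\<^sub>R T x"
  by (rule order_bounded_operatorI;
      intro linear_compose_scale_right order_bounded_scaleR_image order_bounded_operatorD)

instance
  by standard (transfer; simp add: fun_eq_iff algebra_simps)+

end

instantiation ob_operator :: (vector_lattice) ordered_real_vector
begin

lift_definition less_eq_ob_operator :: "'a ob_operator \<Rightarrow> 'a ob_operator \<Rightarrow> bool"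
  is "\<lambda>S T. \<forall>x\<ge>0. S x \<le> T x" .

definition less_ob_operator :: "'a ob_operator \<Rightarrow> 'a ob_operator \<Rightarrow> bool" where
  "less_ob_operator S T \<longleftrightarrow> S \<le> T \<and> \<not> T \<le> S"

lemma ob_operator_antisym:
  fixes S T :: "'a ob_operator"
  assumes "S \<le> T" "T \<le> S"
  shows "S = T"
proof -
  have eq: "ob_apply S x = ob_apply T x" if "0 \<le> x" for x
    using assms that by transfer (auto intro: antisym)
  have "ob_apply S x = ob_apply T x" for x
  proof -
    have x: "x = pprt x + nprt x" by (rule prts)
    have "ob_apply S (- nprt x) = ob_apply T (- nprt x)"
      by (rule eq) simp
    then have n: "ob_apply S (nprt x) = ob_apply T (nprt x)"
      by (simp add: linear_neg[OF linear_ob_apply])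
    have p: "ob_apply S (pprt x) = ob_apply T (pprt x)"
      by (rule eq) simp
    show ?thesis
      by (subst (1 2) x) (simp add: linear_add[OF linear_ob_apply] p n)
  qed
  then show ?thesis by (metis ext ob_apply_inject)
qed

instance
proof
  fix S T U :: "'a ob_operator" and a b :: real
  show "S < T \<longleftrightarrow> S \<le> T \<and> \<not> T \<le> S" by (rule less_ob_operator_def)
  show "S \<le> S" by transfer simp
  show "S \<le> T \<Longrightarrow> T \<le> U \<Longrightarrow> S \<le> U" by transfer (meson order_trans)
  show "S \<le> T \<Longrightarrow> T \<le> S \<Longrightarrow> S = T" by (rule ob_operator_antisym)
  show "S \<le> T \<Longrightarrow> U + S \<le> U + T" by transfer simp
  show "S \<le> T \<Longrightarrow> 0 \<le> a \<Longrightarrow> a *\<^sub>R S \<le> a *\<^sub>R T"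
    by transfer (simp add: scaleR_left_mono)
  show "a \<le> b \<Longrightarrow> 0 \<le> S \<Longrightarrow> a *\<^sub>R S \<le> b *\<^sub>R S"
    by transfer (simp add: scaleR_right_mono)
qed

end

text \<open>
  When the space is Dedekind complete, the operator order is a lattice order (Riesz--Kantorovich).
  The supremum of \<open>T\<close> and \<open>0\<close> is \<open>Sup {T y | 0 \<le> y \<le> x}\<close> at \<open>x \<ge> 0\<close>, extended linearly.
\<close>

definition rk_cone :: "('a \<Rightarrow> 'a) \<Rightarrow> 'a \<Rightarrow> 'a::dedekind_complete_vector_lattice" where
  "rk_cone T x = Sup (T ` {0..x})"

lemma rk_cone_upper:
  assumes T: "order_bounded_operator T" and y: "0 \<le> y" "y \<le> x"
  shows "T y \<le> rk_cone T x"
  unfolding rk_cone_def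
proof (rule cSup_upper)
  have "order_bounded {0..x}" unfolding order_bounded_def by blast
  then have "order_bounded (T ` {0..x})" by (rule order_bounded_operatorD(2)[OF T])
  then obtain a b where "T ` {0..x} \<subseteq> {a..b}" unfolding order_bounded_def by blast
  then show "bdd_above (T ` {0..x})" by (meson bdd_above_Icc bdd_above_mono)
qed (use y in simp)

lemma rk_cone_least:
  assumes "0 \<le> x" "\<And>y. 0 \<le> y \<Longrightarrow> y \<le> x \<Longrightarrow> T y \<le> z"
  shows "rk_cone T x \<le> z"
  unfolding rk_cone_def using assms by (intro cSup_least) auto

lemma rk_cone_add:
  assumes T: "order_bounded_operator T"
    and x: "0 \<le> x" and x': "0 \<le> x'"
  shows "rk_cone T (x + x') = rk_cone T x + rk_cone T x'"
proof (rule antisym)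
  show "rk_cone T (x + x') \<le> rk_cone T x + rk_cone T x'"
  proof (rule rk_cone_least)
    fix y assume y: "0 \<le> y" "y \<le> x + x'"
    define u where "u = inf y x"
    have u: "0 \<le> u" "u \<le> x" using y x by (auto simp: u_def)
    have u0: "0 \<le> y - u" by (simp only: diff_ge_0_iff_ge u_def inf_le1)
    have "y - x' \<le> u" unfolding u_def using y x' by (intro le_infI) (simp_all add: algebra_simps)
    then have u': "y - u \<le> x'" by (simp add: algebra_simps)
    have "T y = T u + T (y - u)" by (simp add: linear_diff[OF order_bounded_operatorD(1)[OF T]])
    also have "\<dots> \<le> rk_cone T x + rk_cone T x'"
      using u u0 u' by (intro add_mono rk_cone_upper[OF T])
    finally show "T y \<le> rk_cone T x + rk_cone T x'" .
  qed (use x x' in simp)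
  have "rk_cone T x \<le> rk_cone T (x + x') - rk_cone T x'"
  proof (rule rk_cone_least[OF x])
    fix y assume y: "0 \<le> y" "y \<le> x"
    have "rk_cone T x' \<le> rk_cone T (x + x') - T y"
    proof (rule rk_cone_least[OF x'])
      fix y' assume y': "0 \<le> y'" "y' \<le> x'"
      have "T (y + y') \<le> rk_cone T (x + x')"
        using y y' by (intro rk_cone_upper[OF T] add_nonneg_nonneg add_mono)
      then show "T y' \<le> rk_cone T (x + x') - T y"
        by (simp add: linear_add[OF order_bounded_operatorD(1)[OF T]] algebra_simps)
    qed
    then show "T y \<le> rk_cone T (x + x') - rk_cone T x'" by (simp add: algebra_simps)
  qed
  then show "rk_cone T x + rk_cone T x' \<le> rk_cone T (x + x')" by (simp add: algebra_simps)
qed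

lemma rk_cone_scaleR:
  assumes T: "order_bounded_operator T"
    and x: "0 \<le> x" and c: "0 \<le> c"
  shows "rk_cone T (c *\<^sub>R x) = c *\<^sub>R rk_cone T x"
proof (cases "c = 0")
  case True
  then show ?thesis by (simp add: rk_cone_def linear_0[OF order_bounded_operatorD(1)[OF T]])
next
  case False
  with c have c: "0 < c" by simp
  have le: "rk_cone T (d *\<^sub>R z) \<le> d *\<^sub>R rk_cone T z" if d: "0 < d" and z: "0 \<le> z" for d z
  proof (rule rk_cone_least)
    show "0 \<le> d *\<^sub>R z" using d z by (simp add: scaleR_nonneg_nonneg)
    fix y assume y: "0 \<le> y" "y \<le> d *\<^sub>R z"
    have 0: "0 \<le> inverse d *\<^sub>R y" using d y by (simp add: scaleR_nonneg_nonneg)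
    have "inverse d *\<^sub>R y \<le> inverse d *\<^sub>R d *\<^sub>R z"
      using d y by (intro scaleR_left_mono) auto
    then have "inverse d *\<^sub>R y \<le> z" using d by simp
    with 0 have "T (inverse d *\<^sub>R y) \<le> rk_cone T z" by (rule rk_cone_upper[OF T])
    then have "d *\<^sub>R T (inverse d *\<^sub>R y) \<le> d *\<^sub>R rk_cone T z"
      using d by (intro scaleR_left_mono) auto
    then show "T y \<le> d *\<^sub>R rk_cone T z" using d by (simp add: linear_scale[OF order_bounded_operatorD(1)[OF T]])
  qed
  have "rk_cone T (inverse c *\<^sub>R c *\<^sub>R x) \<le> inverse c *\<^sub>R rk_cone T (c *\<^sub>R x)"
    using c x by (intro le) (auto simp: scaleR_nonneg_nonneg)
  then have "c *\<^sub>R rk_cone T x \<le> c *\<^sub>R inverse c *\<^sub>R rk_cone T (c *\<^sub>R x)"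
    using c by (intro scaleR_left_mono) auto
  then have "c *\<^sub>R rk_cone T x \<le> rk_cone T (c *\<^sub>R x)" using c by simp
  then show ?thesis using le[OF c x] by (intro antisym)
qed

lift_definition ob_pprt ::
    "'a::dedekind_complete_vector_lattice ob_operator \<Rightarrow> 'a ob_operator"
  is "\<lambda>T x. rk_cone T (pprt x) - rk_cone T (- nprt x)"
proof -
  fix T :: "'a \<Rightarrow> 'a"
  assume T: "order_bounded_operator T"
  let ?P = "\<lambda>x. rk_cone T (pprt x) - rk_cone T (- nprt x)"
  have P: "?P (a - b) = rk_cone T a - rk_cone T b" if "0 \<le> a" "0 \<le> b" for a b
  proof -
    have "pprt (a - b) + b = a + - nprt (a - b)"
      using prts[of "a - b"] by (simp add: algebra_simps)
    then have "rk_cone T (pprt (a - b) + b) = rk_cone T (a + - nprt (a - b))" by simp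
    also have "rk_cone T (pprt (a - b) + b) = rk_cone T (pprt (a - b)) + rk_cone T b"
      using that by (intro rk_cone_add[OF T]) auto
    also have "rk_cone T (a + - nprt (a - b)) = rk_cone T a + rk_cone T (- nprt (a - b))"
      using that by (intro rk_cone_add[OF T]) auto
    finally show ?thesis by (simp add: algebra_simps)
  qed
  have split: "x = pprt x - (- nprt x)" for x :: 'a
    using prts[of x] by simp
  have nn: "0 \<le> pprt x" "0 \<le> - nprt x" for x :: 'a by auto
  have add: "?P (x + y) = ?P x + ?P y" for x y
  proof -
    have "x + y = (pprt x + pprt y) - (- nprt x + - nprt y)"
      by (subst (1) prts[of x], subst (1) prts[of y]) (simp add: algebra_simps)
    then have "?P (x + y) = ?P ((pprt x + pprt y) - (- nprt x + - nprt y))" by simp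
    also have "\<dots> = rk_cone T (pprt x + pprt y) - rk_cone T (- nprt x + - nprt y)"
      by (intro P add_nonneg_nonneg nn)
    also have "\<dots> = ?P x + ?P y"
      using nn by (simp only: rk_cone_add[OF T]) (simp add: algebra_simps)
    finally show ?thesis .
  qed
  have scale: "?P (c *\<^sub>R x) = c *\<^sub>R ?P x" for c x
  proof (cases "0 \<le> c")
    case True
    have "c *\<^sub>R x = c *\<^sub>R pprt x - c *\<^sub>R (- nprt x)"
      using arg_cong[OF split, of "scaleR c" x] by (simp only: scaleR_diff_right)
    then have "?P (c *\<^sub>R x) = ?P (c *\<^sub>R pprt x - c *\<^sub>R (- nprt x))" by simp
    also have "\<dots> = rk_cone T (c *\<^sub>R pprt x) - rk_cone T (c *\<^sub>R (- nprt x))"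
      by (intro P scaleR_nonneg_nonneg True nn)
    also have "\<dots> = c *\<^sub>R ?P x"
      by (simp only: rk_cone_scaleR[OF T nn(1) True] rk_cone_scaleR[OF T nn(2) True]
          scaleR_diff_right)
    finally show ?thesis .
  next
    case False
    then have c: "0 \<le> - c" by simp
    have "c *\<^sub>R x = (- c) *\<^sub>R (- nprt x) - (- c) *\<^sub>R pprt x"
      by (subst (1) prts[of x]) (simp add: scaleR_add_right)
    then have "?P (c *\<^sub>R x) = ?P ((- c) *\<^sub>R (- nprt x) - (- c) *\<^sub>R pprt x)" by simp
    also have "\<dots> = rk_cone T ((- c) *\<^sub>R (- nprt x)) - rk_cone T ((- c) *\<^sub>R pprt x)"
      by (intro P scaleR_nonneg_nonneg c nn)
    also have "\<dots> = c *\<^sub>R ?P x"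
      by (simp only: rk_cone_scaleR[OF T nn(1) c] rk_cone_scaleR[OF T nn(2) c])
        (simp add: scaleR_diff_right)
    finally show ?thesis .
  qed
  have linP: "linear ?P" using add scale by (intro linearI)
  have pos: "0 \<le> ?P x" if "0 \<le> x" for x
  proof -
    have "?P (x - 0) = rk_cone T x - rk_cone T 0" using that by (intro P) auto
    moreover have "rk_cone T 0 = 0" by (simp add: rk_cone_def linear_0[OF order_bounded_operatorD(1)[OF T]])
    moreover have "T 0 \<le> rk_cone T x" using that by (intro rk_cone_upper[OF T]) auto
    ultimately show ?thesis by (simp add: linear_0[OF order_bounded_operatorD(1)[OF T]])
  qed
  have "order_bounded (?P ` A)" if A: "order_bounded A" for A
  proof -
    obtain a b where ab: "A \<subseteq> {a..b}" using A unfolding order_bounded_def by blast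
    have "?P ` A \<subseteq> {?P a..?P b}"
    proof
      fix z assume "z \<in> ?P ` A"
      then obtain x where x: "x \<in> A" "z = ?P x" by blast
      then have "a \<le> x" "x \<le> b" using ab by auto
      then have "0 \<le> ?P (x - a)" "0 \<le> ?P (b - x)" by (intro pos; simp)+
      then show "z \<in> {?P a..?P b}"
        unfolding linear_diff[OF linP] using x by simp
    qed
    then show ?thesis unfolding order_bounded_def by blast
  qed
  with linP show "order_bounded_operator ?P" by (rule order_bounded_operatorI)
qed

lemma ob_pprt_apply:
  assumes "0 \<le> x"
  shows "ob_apply (ob_pprt T) x = rk_cone (ob_apply T) x"
  using assms
  by (simp add: ob_pprt.rep_eq rk_cone_def linear_0[OF linear_ob_apply])

lemma ob_pprt_ge: "T \<le> ob_pprt T"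
  unfolding less_eq_ob_operator.rep_eq
  by (auto simp: ob_pprt_apply intro: rk_cone_upper order_bounded_operator_ob_apply)

lemma ob_pprt_nonneg: "0 \<le> ob_pprt T"
  unfolding less_eq_ob_operator.rep_eq zero_ob_operator.rep_eq
proof (intro allI impI)
  fix x :: 'a assume x: "0 \<le> x"
  have "ob_apply T 0 \<le> rk_cone (ob_apply T) x"
    using x by (intro rk_cone_upper order_bounded_operator_ob_apply) auto
  then show "0 \<le> ob_apply (ob_pprt T) x"
    using x by (simp add: ob_pprt_apply linear_0[OF linear_ob_apply])
qed

lemma ob_pprt_least:
  assumes "T \<le> U" "0 \<le> U"
  shows "ob_pprt T \<le> U"
  unfolding less_eq_ob_operator.rep_eq
proof (intro allI impI)
  fix x :: 'a assume x: "0 \<le> x"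
  have "rk_cone (ob_apply T) x \<le> ob_apply U x"
  proof (rule rk_cone_least[OF x])
    fix y assume y: "0 \<le> y" "y \<le> x"
    have "ob_apply T y \<le> ob_apply U y"
      using assms(1) y by (simp add: less_eq_ob_operator.rep_eq)
    also have "0 \<le> ob_apply U (x - y)"
      using assms(2) y by (simp add: less_eq_ob_operator.rep_eq zero_ob_operator.rep_eq)
    then have "ob_apply U y \<le> ob_apply U x" by (simp add: linear_diff[OF linear_ob_apply])
    finally show "ob_apply T y \<le> ob_apply U x" .
  qed
  then show "ob_apply (ob_pprt T) x \<le> ob_apply U x" by (simp add: ob_pprt_apply x)
qed

instantiation ob_operator :: (dedekind_complete_vector_lattice) vector_lattice
begin

definition sup_ob_operator :: "'a ob_operator \<Rightarrow> 'a ob_operator \<Rightarrow> 'a ob_operator" where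
  "sup_ob_operator S T = T + ob_pprt (S - T)"

definition inf_ob_operator :: "'a ob_operator \<Rightarrow> 'a ob_operator \<Rightarrow> 'a ob_operator" where
  "inf_ob_operator S T = S - ob_pprt (S - T)"

definition abs_ob_operator :: "'a ob_operator \<Rightarrow> 'a ob_operator" where
  "abs_ob_operator T = sup T (- T)"

instance
proof
  fix S T U :: "'a ob_operator"
  show "S \<le> sup S T"
    using ob_pprt_ge[of "S - T"] by (simp add: sup_ob_operator_def algebra_simps)
  show "T \<le> sup S T"
    using ob_pprt_nonneg[of "S - T"] by (simp add: sup_ob_operator_def)
  show "sup T U \<le> S" if "T \<le> S" "U \<le> S"
    using ob_pprt_least[of "T - U" "S - U"] that
    by (simp add: sup_ob_operator_def algebra_simps)
  show "inf S T \<le> S"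
    using ob_pprt_nonneg[of "S - T"] by (simp add: inf_ob_operator_def)
  show "inf S T \<le> T"
    using ob_pprt_ge[of "S - T"] by (simp add: inf_ob_operator_def algebra_simps)
  show "S \<le> inf T U" if "S \<le> T" "S \<le> U"
    using ob_pprt_least[of "T - U" "T - S"] that
    by (simp add: inf_ob_operator_def algebra_simps)
  show "\<bar>S\<bar> = sup S (- S)" by (rule abs_ob_operator_def)
qed

end

definition Orth :: "'a::vector_lattice ob_operator set" where
  "Orth = {T. \<forall>B. band B \<longrightarrow> ob_apply T ` B \<subseteq> B}"

definition SUO_tendsto ::
    "'i set \<Rightarrow> 'i rel \<Rightarrow> ('i \<Rightarrow> 'a::vector_lattice ob_operator) \<Rightarrow> 'a ob_operator \<Rightarrow> bool" where
  "SUO_tendsto A r F T \<longleftrightarrow> (\<forall>x. uo_tendsto A r (\<lambda>a. ob_apply (F a) x) (ob_apply T x))"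

end

theory Submission
  imports Defs
begin

text \<open>
  Orthomorphisms behave like multiplication operators, and the proof makes this precise just far
  enough to compare pointwise convergence with convergence in the operator lattice.

  In a Dedekind complete space an operator is band preserving exactly when it sends disjoint
  \<open>x, y\<close> to disjoint \<open>T x, y\<close> (\<open>Orth_disjoint\<close>, \<open>OrthI\<close>).  The key fact is that lattice operations of
  orthomorphisms are computed pointwise on positive elements: \<open>T\<^sup>+ x = (T x)\<^sup>+\<close>
  (\<open>Orth_ob_pprt_apply\<close>), hence \<open>\<bar>T\<bar> x = \<bar>T x\<bar>\<close>.

  Unbounded order convergence of \<open>f\<close> to \<open>l\<close> says that the eventual upper bounds of
  \<open>inf \<bar>f a - l\<bar> y\<close> have infimum \<open>0\<close> for each \<open>y \<ge> 0\<close>; in other words, nothing strictly positive lies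
  below the limit superior of that net.  All convergence arguments are carried out in this form
  (\<open>uo_tendstoI\<close>, \<open>uo_tendsto_limit_le\<close>).

  For nets of orthomorphisms both convergences agree and preserve being an orthomorphism:
  \<^item> If \<open>F\<close> converges to \<open>T\<close> unboundedly in order and \<open>P\<close> is the projection onto a band \<open>B\<close>, then the
    part \<open>U = (1 - P) \<bar>T\<bar> P\<close> of \<open>\<bar>T\<bar>\<close> that leads out of \<open>B\<close> is disjoint from every \<open>F a\<close>, so it lies
    below every \<open>\<bar>F a - T\<bar>\<close> and vanishes in the limit.
  \<^item> From operators to points it suffices to cut off with the identity operator: this controls
    \<open>\<bar>F a x - T x\<bar>\<close> against \<open>\<bar>x\<bar>\<close>, and the band generated by \<open>x\<close> contains everything in sight
    (\<open>below_limsup_disjoint_eq_0\<close>).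
  \<^item> From points to operators, suprema of tails of \<open>inf \<bar>F a - T\<bar> U\<close> are suprema of orthomorphisms,
    hence pointwise suprema, and are estimated at each \<open>x\<close> separately.

  It remains to show that products converge strongly.  Here
  \<open>\<bar>F a (G b x) - S (T x)\<bar> \<le> \<bar>F a\<bar> \<bar>G b x - T x\<bar> + \<bar>F a (T x) - S (T x)\<bar>\<close>, and only the first term is
  a problem, as \<open>F\<close> need not be order bounded.  But for given \<open>\<epsilon>\<close> and for late \<open>b\<close>,
  \<open>\<bar>G b x - T x\<bar>\<close> is at most \<open>\<epsilon> \<bar>x\<bar>\<close> on a large band.  Orthomorphisms act on that band separately,
  so there the first term is at most \<open>\<epsilon> \<bar>F a\<bar> \<bar>x\<bar>\<close>, which tends to \<open>\<epsilon> \<bar>S\<bar> \<bar>x\<bar>\<close>.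
\<close>

section \<open>Disjointness and bands\<close>

definition disjoint :: "'a::vector_lattice \<Rightarrow> 'a \<Rightarrow> bool" where
  "disjoint x y \<longleftrightarrow> inf \<bar>x\<bar> \<bar>y\<bar> = 0"

lemma inf_add_le:
  fixes a b c :: "'a::vector_lattice"
  assumes "0 \<le> a" "0 \<le> b" "0 \<le> c"
  shows "inf (a + b) c \<le> inf a c + inf b c"
proof -
  have "inf a c + inf b c = inf (inf (a + b) (c + b)) (inf (a + c) (c + c))"
    by (simp add: add_sup_inf_distribs)
  moreover have "inf (a + b) c \<le> c + b" "inf (a + b) c \<le> a + c" "inf (a + b) c \<le> c + c"
    using assms by (auto intro!: le_infI2)
  ultimately show ?thesis by simp
qed

lemma disjointI: "inf \<bar>x\<bar> \<bar>y\<bar> \<le> 0 \<Longrightarrow> disjoint x y"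
  unfolding disjoint_def by (rule antisym) simp_all

lemma disjoint_sym: "disjoint x y \<Longrightarrow> disjoint y x"
  by (simp add: disjoint_def inf_commute)

lemma disjoint_mono: "disjoint x y \<Longrightarrow> \<bar>u\<bar> \<le> \<bar>x\<bar> \<Longrightarrow> \<bar>v\<bar> \<le> \<bar>y\<bar> \<Longrightarrow> disjoint u v"
  using inf_mono[of "\<bar>u\<bar>" "\<bar>x\<bar>" "\<bar>v\<bar>" "\<bar>y\<bar>"] by (intro disjointI) (simp add: disjoint_def)

lemma disjoint_self: "disjoint x x \<Longrightarrow> x = 0"
  by (simp add: disjoint_def)

lemma disjoint_nonneg_iff: "0 \<le> x \<Longrightarrow> 0 \<le> y \<Longrightarrow> disjoint x y \<longleftrightarrow> inf x y = 0"
  by (simp add: disjoint_def)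

lemma disjoint_zero [simp]: "disjoint 0 x" "disjoint x 0"
  by (simp_all add: disjoint_def inf.absorb1 inf.absorb2)

lemma disjoint_uminus: "disjoint x y \<Longrightarrow> disjoint (- x) y"
  by (simp add: disjoint_def)

lemma disjoint_add:
  assumes "disjoint x z" "disjoint y z"
  shows "disjoint (x + y) z"
proof (rule disjointI)
  have "inf \<bar>x + y\<bar> \<bar>z\<bar> \<le> inf (\<bar>x\<bar> + \<bar>y\<bar>) \<bar>z\<bar>"
    by (intro inf_mono abs_triangle_ineq order_refl)
  also have "\<dots> \<le> inf \<bar>x\<bar> \<bar>z\<bar> + inf \<bar>y\<bar> \<bar>z\<bar>" by (intro inf_add_le) auto
  finally show "inf \<bar>x + y\<bar> \<bar>z\<bar> \<le> 0" using assms by (simp add: disjoint_def)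
qed

lemma disjoint_diff: "disjoint x z \<Longrightarrow> disjoint y z \<Longrightarrow> disjoint (x - y) z"
  using disjoint_add[of x z "- y"] by (simp add: disjoint_uminus)

lemma abs_scaleR_le:
  fixes x :: "'a::vector_lattice"
  shows "\<bar>c *\<^sub>R x\<bar> \<le> \<bar>c\<bar> *\<^sub>R \<bar>x\<bar>"
proof (rule abs_leI)
  have *: "d *\<^sub>R x \<le> \<bar>d\<bar> *\<^sub>R \<bar>x\<bar>" for d
  proof (cases "0 \<le> d")
    case True
    then show ?thesis by (simp add: scaleR_left_mono abs_ge_self)
  next
    case False
    then have "(- d) *\<^sub>R (- x) \<le> (- d) *\<^sub>R \<bar>x\<bar>"
      using abs_ge_minus_self[of x] by (intro scaleR_left_mono) auto
    then show ?thesis using False by simp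
  qed
  show "c *\<^sub>R x \<le> \<bar>c\<bar> *\<^sub>R \<bar>x\<bar>" by (rule *)
  show "- (c *\<^sub>R x) \<le> \<bar>c\<bar> *\<^sub>R \<bar>x\<bar>" using *[of "- c"] by simp
qed

lemma disjoint_scaleR:
  assumes "disjoint x z"
  shows "disjoint (c *\<^sub>R x) z"
proof (rule disjointI)
  define k where "k = max 1 \<bar>c\<bar>"
  have k: "1 \<le> k" "\<bar>c\<bar> \<le> k" "0 < k" by (auto simp: k_def)
  let ?u = "inf (k *\<^sub>R \<bar>x\<bar>) (k *\<^sub>R \<bar>z\<bar>)"
  have "\<bar>c *\<^sub>R x\<bar> \<le> k *\<^sub>R \<bar>x\<bar>"
    using abs_scaleR_le[of c x] scaleR_right_mono[OF k(2), of "\<bar>x\<bar>"] by auto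
  moreover have "\<bar>z\<bar> \<le> k *\<^sub>R \<bar>z\<bar>"
    using scaleR_right_mono[OF k(1), of "\<bar>z\<bar>"] by simp
  ultimately have "inf \<bar>c *\<^sub>R x\<bar> \<bar>z\<bar> \<le> ?u" by (rule inf_mono)
  also have "?u \<le> 0"
  proof -
    have "inverse k *\<^sub>R ?u \<le> inverse k *\<^sub>R k *\<^sub>R \<bar>x\<bar>" "inverse k *\<^sub>R ?u \<le> inverse k *\<^sub>R k *\<^sub>R \<bar>z\<bar>"
      using k by (intro scaleR_left_mono; simp)+
    then have "inverse k *\<^sub>R ?u \<le> inf \<bar>x\<bar> \<bar>z\<bar>" using k by simp
    then have "inverse k *\<^sub>R ?u \<le> 0" using assms by (simp only: disjoint_def)
    then have "k *\<^sub>R inverse k *\<^sub>R ?u \<le> k *\<^sub>R 0" using k by (intro scaleR_left_mono) auto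
    then show ?thesis using k by simp
  qed
  finally show "inf \<bar>c *\<^sub>R x\<bar> \<bar>z\<bar> \<le> 0" .
qed

lemma disjoint_pprt_pprt_uminus: "disjoint (pprt x) (pprt (- x))"
proof -
  have "pprt x + pprt (- x) = sup (pprt x) (pprt (- x))"
  proof -
    have "pprt x + pprt (- x) = \<bar>x\<bar>" by (simp add: abs_prts pprt_neg)
    also have "\<bar>x\<bar> = sup x (- x)" by (simp add: abs_lattice)
    also have "\<dots> \<le> sup (pprt x) (pprt (- x))" by (intro sup_mono) (simp_all add: pprt_def)
    finally have "pprt x + pprt (- x) \<le> sup (pprt x) (pprt (- x))" .
    moreover have "sup (pprt x) (pprt (- x)) \<le> pprt x + pprt (- x)"
      by (intro sup_least) simp_all
    ultimately show ?thesis by (rule antisym)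
  qed
  then have "inf (pprt x) (pprt (- x)) = 0"
    using add_eq_inf_sup[of "pprt x" "pprt (- x)"] by simp
  then show ?thesis by (simp add: disjoint_def)
qed

lemma disjoint_add_eq_sup:
  assumes "disjoint x y" "0 \<le> x" "0 \<le> y"
  shows "x + y = sup x y"
  using assms by (subst add_eq_inf_sup) (simp add: disjoint_nonneg_iff)

lemma pprt_add_disj:
  assumes "disjoint x y"
  shows "pprt (x + y) = pprt x + pprt y"
proof -
  have parts: "\<bar>pprt z\<bar> \<le> \<bar>z\<bar>" "\<bar>pprt (- z)\<bar> \<le> \<bar>z\<bar>" for z :: 'a
    by (simp_all add: abs_prts pprt_neg)
  have d: "disjoint (pprt x + pprt y) (pprt (- x) + pprt (- y))"
  proof (rule disjoint_add; rule disjoint_sym; rule disjoint_add)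
    show "disjoint (pprt (- x)) (pprt x)" "disjoint (pprt (- y)) (pprt y)"
      by (rule disjoint_sym[OF disjoint_pprt_pprt_uminus])+
    show "disjoint (pprt (- y)) (pprt x)"
      by (rule disjoint_mono[OF disjoint_sym[OF assms] parts(2) parts(1)])
    show "disjoint (pprt (- x)) (pprt y)"
      by (rule disjoint_mono[OF assms parts(2) parts(1)])
  qed
  have eq: "x + y = (pprt x + pprt y) - (pprt (- x) + pprt (- y))"
    by (subst (1) prts[of x], subst (1) prts[of y]) (simp add: pprt_neg algebra_simps)
  have pp: "pprt (u - v) = u" if "disjoint u v" "0 \<le> u" "0 \<le> v" for u v :: 'a
  proof -
    have "pprt (u - v) = sup (u - v) (v - v)" by (simp add: pprt_def)
    also have "\<dots> = sup u v - v"
      using add_sup_distrib_right[of u v "- v"] by simp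
    also have "\<dots> = u" using disjoint_add_eq_sup[OF that] by (metis add_diff_cancel_right')
    finally show ?thesis .
  qed
  show ?thesis unfolding eq by (intro pp d add_nonneg_nonneg) simp_all
qed

lemma pprt_eq_0_iff: "pprt x = 0 \<longleftrightarrow> x \<le> 0"
  by (simp add: le_zero_iff_zero_pprt)

lemma inf_add_pprt_diff:
  fixes x t :: "'a::vector_lattice"
  shows "inf t x + pprt (x - t) = x"
proof -
  have "pprt (x - t) = sup (x - t) (t - t)" by (simp add: pprt_def)
  also have "\<dots> = sup t x - t"
    using add_sup_distrib_right[of x t "- t"] by (simp add: sup_commute)
  finally have *: "pprt (x - t) = sup t x - t" .
  show ?thesis unfolding * using add_eq_inf_sup[of t x] by (simp add: algebra_simps)
qed

lemma le_pprt_diff_add: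
  fixes x y :: "'a::vector_lattice"
  shows "x \<le> pprt (x - y) + y"
proof -
  have "x - y \<le> pprt (x - y)" by (simp add: pprt_def)
  then show ?thesis by (simp only: diff_le_eq)
qed

definition dcompl :: "'a::vector_lattice set \<Rightarrow> 'a set" where
  "dcompl A = {x. \<forall>a\<in>A. disjoint x a}"

text \<open>
  Infinite distributivity in disguise: if \<open>a\<close> is disjoint from \<open>D\<close> and \<open>x\<close> is the supremum of \<open>D\<close>, then
  whatever \<open>x - d\<close> has in common with \<open>\<bar>a\<bar>\<close> could be subtracted from \<open>x\<close> without losing the upper
  bound property.  Relative to a fixed \<open>d \<in> D\<close> all elements involved are positive.
\<close>

lemma band_dcompl: "band (dcompl A)"
  unfolding band_def ideal_def
proof (intro conjI allI impI)
  show "subspace (dcompl A)"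
    by (auto simp: subspace_def dcompl_def intro: disjoint_add disjoint_scaleR)
  show "x \<in> dcompl A" if "y \<in> dcompl A" "\<bar>x\<bar> \<le> \<bar>y\<bar>" for x y
    using that by (auto simp: dcompl_def intro: disjoint_mono)
  fix D x assume D: "D \<subseteq> dcompl A" and lub: "isLub UNIV D x"
  have ub: "d \<le> x" if "d \<in> D" for d
    using isLubD2[OF lub that] .
  have least: "x \<le> u" if "\<And>d. d \<in> D \<Longrightarrow> d \<le> u" for u
    using isLub_le_isUb[OF lub] that by (simp add: isUbI setleI)
  show "x \<in> dcompl A"
  proof (cases "D = {}")
    \<comment> \<open>The supremum of the empty set is a least element, so the space is trivial.\<close>
    case True
    then have *: "x \<le> v" for v using least[of v] by blast
    then have "x \<le> 0" "x \<le> x + x" by blast+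
    then have "x = 0" by (intro antisym) simp_all
    then show ?thesis by (simp add: dcompl_def)
  next
    case False
    then obtain d where d: "d \<in> D" by blast
    have "disjoint x a" if a: "a \<in> A" for a
    proof -
      define w where "w = inf (x - d) \<bar>a\<bar>"
      have w: "0 \<le> w" using ub[OF d] by (simp add: w_def)
      have "d' \<le> x - w" if d': "d' \<in> D" for d'
      proof -
        let ?e = "pprt (d' - d)"
        have "disjoint (d' - d) a" using D d d' a by (intro disjoint_diff) (auto simp: dcompl_def)
        then have "disjoint ?e w"
          by (rule disjoint_mono) (use w in \<open>simp_all add: w_def abs_prts\<close>)
        then have "?e + w = sup ?e w" using w by (intro disjoint_add_eq_sup) simp_all
        also have "\<dots> \<le> x - d"
          using ub[OF d] ub[OF d'] by (intro sup_least) (simp_all add: w_def pprt_def)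
        finally have "?e + w \<le> x - d" .
        moreover have "d' - d \<le> ?e" by (simp add: pprt_def)
        ultimately have "d' - d + w \<le> x - d" by (meson add_right_mono order_trans)
        then show ?thesis by (simp add: algebra_simps)
      qed
      then have "x \<le> x - w" by (rule least)
      then have "w = 0" using w by simp
      then have "disjoint (x - d) a" using ub[OF d] by (simp add: disjoint_def w_def)
      moreover have "disjoint d a" using D d a by (auto simp: dcompl_def)
      ultimately show ?thesis using disjoint_add[of "x - d" a d] by simp
    qed
    then show ?thesis by (simp add: dcompl_def)
  qed
qed

lemma band_add: "band B \<Longrightarrow> x \<in> B \<Longrightarrow> y \<in> B \<Longrightarrow> x + y \<in> B"
  by (auto simp: band_def ideal_def subspace_def)

lemma band_scaleR: "band B \<Longrightarrow> x \<in> B \<Longrightarrow> c *\<^sub>R x \<in> B"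
  by (auto simp: band_def ideal_def subspace_def)

lemma band_diff: "band B \<Longrightarrow> x \<in> B \<Longrightarrow> y \<in> B \<Longrightarrow> x - y \<in> B"
  using band_add[of B x "(- 1) *\<^sub>R y"] band_scaleR[of B y "- 1"] by simp

lemma band_zero: "band B \<Longrightarrow> 0 \<in> B"
  by (auto simp: band_def ideal_def subspace_def)

lemma band_solid: "band B \<Longrightarrow> y \<in> B \<Longrightarrow> \<bar>x\<bar> \<le> \<bar>y\<bar> \<Longrightarrow> x \<in> B"
  by (auto simp: band_def ideal_def)

lemma disjoint_dcompl: "x \<in> A \<Longrightarrow> y \<in> dcompl A \<Longrightarrow> disjoint x y"
  unfolding dcompl_def by (blast dest: disjoint_sym)

lemma dcompl_Int: "x \<in> A \<Longrightarrow> x \<in> dcompl A \<Longrightarrow> x = 0"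
  using disjoint_self by (auto simp: dcompl_def)

text \<open>
  The component of \<open>x\<close> in \<open>B\<close> is the largest element of \<open>B\<close> between \<open>0\<close> and \<open>x\<close>: anything in \<open>B\<close> below
  the remainder could still be added to it.
\<close>

lemma band_decomposition_nonneg:
  fixes x :: "'a::dedekind_complete_vector_lattice"
  assumes B: "band B" and x: "0 \<le> x"
  obtains u where "0 \<le> u" "u \<le> x" "u \<in> B" "x - u \<in> dcompl B"
proof -
  define D where "D = {u \<in> B. 0 \<le> u \<and> u \<le> x}"
  have 0: "0 \<in> D" using band_zero[OF B] x by (simp add: D_def)
  have bdd: "bdd_above D" by (auto simp: D_def bdd_above_def)
  define u where "u = Sup D"
  have ub: "d \<le> u" if "d \<in> D" for d unfolding u_def by (rule cSup_upper[OF that bdd])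
  have least: "u \<le> v" if "\<And>d. d \<in> D \<Longrightarrow> d \<le> v" for v
    unfolding u_def using 0 that by (intro cSup_least) auto
  have "isLub UNIV D u"
    using ub least by (auto simp: isLub_def isUb_def leastP_def setle_def setge_def)
  moreover have "D \<subseteq> B" by (auto simp: D_def)
  ultimately have uB: "u \<in> B" using B unfolding band_def by blast
  have ux: "u \<le> x" by (rule least) (simp add: D_def)
  have "disjoint (x - u) b" if b: "b \<in> B" for b
  proof -
    define w where "w = inf (x - u) \<bar>b\<bar>"
    have w: "0 \<le> w" "w \<le> x - u" using ux by (simp_all add: w_def)
    have wB: "w \<in> B" using w(1) by (intro band_solid[OF B b]) (simp add: w_def)
    have "d \<le> u - w" if d: "d \<in> D" for d
    proof -
      have "d + w \<le> u + (x - u)" by (intro add_mono ub d w)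
      then have "d + w \<in> D"
        using d w wB band_add[OF B] by (auto simp: D_def)
      then show ?thesis using ub[of "d + w"] by (simp add: algebra_simps)
    qed
    then have "u \<le> u - w" by (rule least)
    then have "w = 0" using w by simp
    then show ?thesis using ux by (simp add: disjoint_def w_def)
  qed
  then show ?thesis using that[OF ub[OF 0] ux uB] by (simp add: dcompl_def)
qed

lemma band_decomposition:
  fixes x :: "'a::dedekind_complete_vector_lattice"
  assumes B: "band B"
  shows "\<exists>u. u \<in> B \<and> x - u \<in> dcompl B"
proof -
  obtain u where u: "u \<in> B" "pprt x - u \<in> dcompl B"
    using band_decomposition_nonneg[OF B, of "pprt x"] by auto
  obtain v where v: "v \<in> B" "pprt (- x) - v \<in> dcompl B"
    using band_decomposition_nonneg[OF B, of "pprt (- x)"] by auto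
  have "x - (u - v) = (pprt x - u) - (pprt (- x) - v)"
    using prts[of x] by (simp add: pprt_neg algebra_simps)
  then have "x - (u - v) \<in> dcompl B"
    using band_diff[OF band_dcompl u(2) v(2)] by (simp only:)
  then show ?thesis using band_diff[OF B u(1) v(1)] by blast
qed

lemma dcompl_dcompl_band:
  fixes B :: "'a::dedekind_complete_vector_lattice set"
  assumes B: "band B"
  shows "dcompl (dcompl B) = B"
proof
  show "B \<subseteq> dcompl (dcompl B)" unfolding dcompl_def by (blast dest: disjoint_sym)
  show "dcompl (dcompl B) \<subseteq> B"
  proof
    fix x assume x: "x \<in> dcompl (dcompl B)"
    obtain u where u: "u \<in> B" "x - u \<in> dcompl B" using band_decomposition[OF B] by blast
    have "u \<in> dcompl (dcompl B)" using u(1) disjoint_dcompl[of u B] by (auto simp: dcompl_def)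
    then have "x - u \<in> dcompl (dcompl B)" by (intro band_diff[OF band_dcompl] x)
    then have "x - u = 0" using u(2) by (intro dcompl_Int)
    then show "x \<in> B" using u(1) by simp
  qed
qed

section \<open>Tails of nets\<close>

text \<open>
  For nets of positive elements, order convergence to \<open>0\<close> means that the eventual upper bounds have
  infimum \<open>0\<close>.  This form does not refer to an auxiliary dominating net.
\<close>

definition dominates :: "'i set \<Rightarrow> 'i rel \<Rightarrow> ('i \<Rightarrow> 'a::vector_lattice) \<Rightarrow> 'a \<Rightarrow> bool" where
  "dominates A r z h \<longleftrightarrow> (\<exists>a0\<in>A. \<forall>a. (a0, a) \<in> r \<longrightarrow> z a \<le> h)"

text \<open>
  Stated through eventual upper bounds instead of suprema of tails, so that it serves for nets of
  operators as well as for nets in the space itself.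
\<close>

definition below_limsup :: "'i set \<Rightarrow> 'i rel \<Rightarrow> ('i \<Rightarrow> 'a::vector_lattice) \<Rightarrow> 'a \<Rightarrow> bool" where
  "below_limsup A r z w \<longleftrightarrow> (\<forall>h. dominates A r z h \<longrightarrow> w \<le> h)"

lemma directed_onD:
  assumes "directed_on A r"
  shows "\<exists>a. a \<in> A" and "a \<in> A \<Longrightarrow> (a, a) \<in> r"
    and "(a, b) \<in> r \<Longrightarrow> (b, c) \<in> r \<Longrightarrow> (a, c) \<in> r"
    and "(a, b) \<in> r \<Longrightarrow> a \<in> A \<and> b \<in> A"
    and "a \<in> A \<Longrightarrow> b \<in> A \<Longrightarrow> \<exists>c\<in>A. (a, c) \<in> r \<and> (b, c) \<in> r"
proof -
  have r: "A \<noteq> {}" "r \<subseteq> A \<times> A" "refl_on A r" "trans r"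
    using assms by (simp_all add: directed_on_def preorder_on_def)
  show "\<exists>a. a \<in> A" using r(1) by blast
  show "a \<in> A \<Longrightarrow> (a, a) \<in> r" using r(3) by (rule refl_onD)
  show "(a, b) \<in> r \<Longrightarrow> (b, c) \<in> r \<Longrightarrow> (a, c) \<in> r" using r(4) by (rule transD)
  show "(a, b) \<in> r \<Longrightarrow> a \<in> A \<and> b \<in> A" using r(2) by blast
  show "a \<in> A \<Longrightarrow> b \<in> A \<Longrightarrow> \<exists>c\<in>A. (a, c) \<in> r \<and> (b, c) \<in> r"
    using assms by (simp add: directed_on_def)
qed

lemma dominatesI: "a0 \<in> A \<Longrightarrow> (\<And>a. (a0, a) \<in> r \<Longrightarrow> z a \<le> h) \<Longrightarrow> dominates A r z h"
  by (auto simp: dominates_def)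

lemma dominatesE:
  assumes "dominates A r z h"
  obtains a0 where "a0 \<in> A" "\<And>a. (a0, a) \<in> r \<Longrightarrow> z a \<le> h"
  using assms by (auto simp: dominates_def)

lemma dominates_inf:
  assumes A: "directed_on A r" and "dominates A r z h" "dominates A r z k"
  shows "dominates A r z (inf h k)"
proof -
  obtain a where a: "a \<in> A" "\<And>c. (a, c) \<in> r \<Longrightarrow> z c \<le> h" by (rule dominatesE[OF assms(2)]) blast
  obtain b where b: "b \<in> A" "\<And>c. (b, c) \<in> r \<Longrightarrow> z c \<le> k" by (rule dominatesE[OF assms(3)]) blast
  obtain c where c: "c \<in> A" "(a, c) \<in> r" "(b, c) \<in> r"
    using directed_onD(5)[OF A a(1) b(1)] by blast
  show ?thesis
  proof (rule dominatesI[OF c(1)])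
    fix d assume "(c, d) \<in> r"
    then have "(a, d) \<in> r" "(b, d) \<in> r" using directed_onD(3)[OF A] c by blast+
    then show "z d \<le> inf h k" using a(2) b(2) by simp
  qed
qed

lemma dominates_point:
  assumes A: "directed_on A r" and "dominates A r z h"
  obtains a where "a \<in> A" "z a \<le> h"
  using dominatesE[OF assms(2)] directed_onD(2)[OF A] by blast

text \<open>
  The eventual upper bounds of a net are closed under binary infima, so they form themselves a
  decreasing net indexed by the reversed order, and it dominates the given net by construction.
\<close>

lemma uo_tendstoI:
  assumes A: "directed_on A r"
    and lim: "\<And>y w. 0 \<le> y \<Longrightarrow> 0 \<le> w \<Longrightarrow> below_limsup A r (\<lambda>a. inf \<bar>f a - l\<bar> y) w \<Longrightarrow> w = 0"
  shows "uo_tendsto A r f l"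
  unfolding uo_tendsto_def
proof (intro allI impI)
  fix y :: 'b assume y: "0 \<le> y"
  let ?z = "\<lambda>a. inf \<bar>f a - l\<bar> y"
  let ?H = "{h. dominates A r ?z h}"
  let ?s = "{(u, v). u \<in> ?H \<and> v \<in> ?H \<and> v \<le> u}"
  obtain a where a: "a \<in> A" using directed_onD(1)[OF A] by blast
  have yH: "y \<in> ?H" by (auto intro: dominatesI[OF a])
  have pos: "0 \<le> h" if h: "h \<in> ?H" for h
  proof -
    obtain a where "?z a \<le> h" by (rule dominates_point[OF A, of ?z h]) (use h in auto)
    moreover have "0 \<le> ?z a" using y by simp
    ultimately show ?thesis by (rule order_trans[rotated])
  qed
  show "order_tendsto A r ?z 0"
  proof (rule order_tendstoI)
    show "directed_on ?H ?s"
      unfolding directed_on_def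
    proof (intro conjI ballI)
      show "?H \<noteq> {}" using yH by blast
      show "preorder_on ?H ?s" by (auto simp: preorder_on_def refl_on_def trans_def)
      fix u v assume "u \<in> ?H" "v \<in> ?H"
      then show "\<exists>w\<in>?H. (u, w) \<in> ?s \<and> (v, w) \<in> ?s"
        using dominates_inf[OF A, of ?z u v] by (intro bexI[of _ "inf u v"]) auto
    qed
    have "v \<le> 0" if v: "\<And>h. h \<in> ?H \<Longrightarrow> v \<le> h" for v
    proof -
      have "sup v 0 = 0"
        using v pos by (intro lim[OF y]) (auto simp: below_limsup_def)
      then show ?thesis by (metis sup_ge1)
    qed
    then have "isGlb UNIV ((\<lambda>h. h) ` ?H) 0"
      using pos by (auto simp: isGlb_def greatestP_def isLb_def setle_def setge_def)
    then show "decreases_to_zero ?H ?s (\<lambda>h. h)" by (auto simp: decreases_to_zero_def)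
    fix h assume "h \<in> ?H"
    then show "\<exists>a0\<in>A. \<forall>a. (a0, a) \<in> r \<longrightarrow> \<bar>0 - ?z a\<bar> \<le> h"
      using y by (simp add: dominates_def)
  qed
qed

text \<open>
  The form in which convergence is used: an inequality with an eventual upper bound as error term
  holds without the error term.
\<close>

lemma uo_tendsto_limit_le:
  assumes lim: "uo_tendsto A r f l" and y: "0 \<le> y"
    and le: "\<And>h. dominates A r (\<lambda>a. inf \<bar>f a - l\<bar> y) h \<Longrightarrow> u \<le> v + h"
  shows "u \<le> v"
proof -
  let ?z = "\<lambda>a. inf \<bar>f a - l\<bar> y"
  have "order_tendsto A r ?z 0" using lim y by (simp add: uo_tendsto_def)
  then obtain B s and g :: "'b \<Rightarrow> 'b" where g: "decreases_to_zero B s g"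
    and dom: "\<forall>b0\<in>B. \<exists>a0\<in>A. \<forall>a. (a0, a) \<in> r \<longrightarrow> \<bar>0 - ?z a\<bar> \<le> g b0"
    unfolding order_tendsto_def by blast
  have "u - v \<le> g b" if b: "b \<in> B" for b
  proof -
    obtain a0 where "a0 \<in> A" "\<forall>a. (a0, a) \<in> r \<longrightarrow> \<bar>0 - ?z a\<bar> \<le> g b" using dom b by blast
    then have "dominates A r ?z (g b)"
      using y by (simp add: dominates_def) blast
    then have "u \<le> v + g b" by (rule le)
    then show ?thesis by (simp add: algebra_simps)
  qed
  then have "isLb UNIV (g ` B) (u - v)" by (auto simp: isLb_def setge_def)
  moreover have "isGlb UNIV (g ` B) 0" using g by (simp add: decreases_to_zero_def)
  ultimately have "u - v \<le> 0" by (auto simp: isGlb_def greatestP_def setle_def)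
  then show ?thesis by simp
qed

text \<open>
  Infinite distributivity: the infimum with \<open>c\<close> of the supremum of a tail is the supremum of the
  infima with \<open>c\<close>.
\<close>

lemma below_limsup_inf:
  fixes z :: "'i \<Rightarrow> 'a::dedekind_complete_vector_lattice"
  assumes A: "directed_on A r" and w: "below_limsup A r z w"
    and k: "dominates A r z k" and m: "dominates A r (\<lambda>a. inf c (z a)) m"
  shows "inf c w \<le> m"
proof -
  obtain a where a: "a \<in> A" "\<And>d. (a, d) \<in> r \<Longrightarrow> z d \<le> k" by (rule dominatesE[OF k]) blast
  obtain b where b: "b \<in> A" "\<And>d. (b, d) \<in> r \<Longrightarrow> inf c (z d) \<le> m" by (rule dominatesE[OF m]) blast
  obtain e where e: "e \<in> A" "(a, e) \<in> r" "(b, e) \<in> r"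
    using directed_onD(5)[OF A a(1) b(1)] by blast
  have tail: "z d \<le> k" "inf c (z d) \<le> m" if "(e, d) \<in> r" for d
    using a(2) b(2) directed_onD(3)[OF A] e that by blast+
  let ?Z = "z ` {d. (e, d) \<in> r}"
  have ne: "?Z \<noteq> {}" using directed_onD(2)[OF A e(1)] by blast
  have bdd: "bdd_above ?Z" using tail(1) by (auto simp: bdd_above_def)
  have upper: "z d \<le> Sup ?Z" if "(e, d) \<in> r" for d
    using that by (intro cSup_upper[OF _ bdd]) blast
  have "w \<le> Sup ?Z"
    using w upper by (auto simp: below_limsup_def intro: dominatesI[OF e(1)])
  then have "inf c w \<le> inf c (Sup ?Z)" by (rule inf_mono[OF order_refl])
  also have "\<dots> \<le> m"
  proof -
    have "Sup ?Z \<le> m + (sup c (Sup ?Z) - c)"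
    proof (rule cSup_least[OF ne])
      fix u assume "u \<in> ?Z"
      then obtain d where d: "(e, d) \<in> r" "u = z d" by blast
      have "u = inf c u + (sup c u - c)" using add_eq_inf_sup[of c u] by (simp add: algebra_simps)
      also have "\<dots> \<le> m + (sup c (Sup ?Z) - c)"
        using tail(2)[OF d(1)] upper[OF d(1)] d(2)
        by (intro add_mono diff_right_mono sup_mono) simp_all
      finally show "u \<le> m + (sup c (Sup ?Z) - c)" .
    qed
    then show ?thesis using add_eq_inf_sup[of c "Sup ?Z"] by (simp add: algebra_simps)
  qed
  finally show ?thesis .
qed

text \<open>
  If all \<open>z a\<close> belong to the band generated by \<open>x\<close>, then so does everything positive below their limit
  superior, and it is enough to look at its part under \<open>\<bar>x\<bar>\<close>.
\<close>

lemma below_limsup_disjoint_eq_0: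
  fixes z :: "'i \<Rightarrow> 'a::dedekind_complete_vector_lattice"
  assumes A: "directed_on A r" and w: "below_limsup A r z w" "0 \<le> w"
    and k: "dominates A r z k" and x: "inf \<bar>x\<bar> w \<le> 0"
    and z: "\<And>a. a \<in> A \<Longrightarrow> 0 \<le> z a"
    and disjoint: "\<And>a v. a \<in> A \<Longrightarrow> disjoint x v \<Longrightarrow> disjoint (z a) v"
  shows "w = 0"
proof -
  have "disjoint x w" using x w(2) by (intro disjointI) simp
  then have "inf w (z a) = 0" if "a \<in> A" for a
    using disjoint[OF that, of w] z[OF that] w(2) by (simp add: disjoint_nonneg_iff inf_commute)
  moreover obtain a where a: "a \<in> A" using directed_onD(1)[OF A] by blast
  ultimately have "dominates A r (\<lambda>a. inf w (z a)) 0"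
    using directed_onD(4)[OF A] by (intro dominatesI[OF a]) simp
  then have "inf w w \<le> 0" by (rule below_limsup_inf[OF A w(1) k])
  then show ?thesis using w(2) by simp
qed

section \<open>Orthomorphisms\<close>

lemmas ob_apply_add = linear_add[OF linear_ob_apply]
lemmas ob_apply_diff = linear_diff[OF linear_ob_apply]
lemmas ob_apply_scaleR = linear_scale[OF linear_ob_apply]
lemmas ob_apply_0 [simp] = linear_0[OF linear_ob_apply]

lemma ob_apply_nonneg: "0 \<le> T \<Longrightarrow> 0 \<le> x \<Longrightarrow> 0 \<le> ob_apply T x"
  by (simp add: less_eq_ob_operator.rep_eq zero_ob_operator.rep_eq)

lemma ob_apply_mono: "0 \<le> T \<Longrightarrow> x \<le> y \<Longrightarrow> ob_apply T x \<le> ob_apply T y"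
  using ob_apply_nonneg[of T "y - x"] by (simp add: ob_apply_diff)

lemma ob_apply_leD: "S \<le> T \<Longrightarrow> 0 \<le> x \<Longrightarrow> ob_apply S x \<le> ob_apply T x"
  by (simp add: less_eq_ob_operator.rep_eq)

lemma ob_operator_leI: "(\<And>x. 0 \<le> x \<Longrightarrow> ob_apply S x \<le> ob_apply T x) \<Longrightarrow> S \<le> T"
  by (simp add: less_eq_ob_operator.rep_eq)

lemma ob_apply_inf_le:
  assumes "0 \<le> x"
  shows "ob_apply (inf S T) x \<le> inf (ob_apply S x) (ob_apply T x)"
  using ob_apply_leD[OF inf_le1 assms] ob_apply_leD[OF inf_le2 assms] by (rule le_infI)

lemma abs_ob_operator_eq: "\<bar>T\<bar> = ob_pprt T + ob_pprt (- T)"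
proof -
  have "pprt U = ob_pprt U" for U :: "'a ob_operator" by (simp add: pprt_def sup_ob_operator_def)
  then show ?thesis using abs_prts[of T] pprt_neg[of T] by simp
qed

lemma abs_ob_apply_le: "\<bar>ob_apply T x\<bar> \<le> ob_apply \<bar>T\<bar> \<bar>x\<bar>"
proof -
  have *: "\<bar>ob_apply T y\<bar> \<le> ob_apply \<bar>T\<bar> y" if "0 \<le> y" for y
    using ob_apply_leD[OF abs_ge_self that, of T] ob_apply_leD[OF abs_ge_minus_self that, of T]
    by (intro abs_leI) (simp_all add: uminus_ob_operator.rep_eq)
  have x: "x = pprt x - pprt (- x)" using prts[of x] by (simp add: pprt_neg)
  have "\<bar>ob_apply T x\<bar> = \<bar>ob_apply T (pprt x) - ob_apply T (pprt (- x))\<bar>"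
    by (subst x) (rule arg_cong[OF ob_apply_diff])
  also have "\<dots> \<le> \<bar>ob_apply T (pprt x)\<bar> + \<bar>ob_apply T (pprt (- x))\<bar>" by (rule abs_triangle_ineq4)
  also have "\<dots> \<le> ob_apply \<bar>T\<bar> (pprt x) + ob_apply \<bar>T\<bar> (pprt (- x))"
    by (intro add_mono *) simp_all
  also have "\<dots> = ob_apply \<bar>T\<bar> (pprt x + pprt (- x))" by (simp add: ob_apply_add)
  also have "pprt x + pprt (- x) = \<bar>x\<bar>" by (simp add: abs_prts pprt_neg)
  finally show ?thesis .
qed

lemma Orth_disjoint:
  assumes "T \<in> Orth" "disjoint x y"
  shows "disjoint (ob_apply T x) y"
proof -
  have "x \<in> dcompl {y}" using assms(2) by (simp add: dcompl_def)
  then have "ob_apply T x \<in> dcompl {y}"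
    using assms(1) band_dcompl[of "{y}"] unfolding Orth_def by blast
  then show ?thesis by (simp add: dcompl_def)
qed

text \<open>
  Bands are recovered as double disjoint complements.
\<close>

lemma OrthI:
  fixes T :: "'a::dedekind_complete_vector_lattice ob_operator"
  assumes "\<And>x y. disjoint x y \<Longrightarrow> disjoint (ob_apply T x) y"
  shows "T \<in> Orth"
  unfolding Orth_def
proof (intro CollectI allI impI image_subsetI)
  fix B :: "'a set" and x assume B: "band B" and x: "x \<in> B"
  have "ob_apply T x \<in> dcompl (dcompl B)"
    using assms disjoint_dcompl[OF x] by (auto simp: dcompl_def)
  then show "ob_apply T x \<in> B" by (simp add: dcompl_dcompl_band[OF B])
qed

lemma Orth_diff:
  fixes S T :: "'a::dedekind_complete_vector_lattice ob_operator"
  shows "S \<in> Orth \<Longrightarrow> T \<in> Orth \<Longrightarrow> S - T \<in> Orth"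
  by (rule OrthI) (simp add: minus_ob_operator.rep_eq disjoint_diff Orth_disjoint)

lemma Orth_uminus:
  fixes T :: "'a::dedekind_complete_vector_lattice ob_operator"
  shows "T \<in> Orth \<Longrightarrow> - T \<in> Orth"
  by (rule OrthI) (simp add: uminus_ob_operator.rep_eq disjoint_uminus Orth_disjoint)

lemma Orth_compose:
  fixes S T :: "'a::dedekind_complete_vector_lattice ob_operator"
  shows "S \<in> Orth \<Longrightarrow> T \<in> Orth \<Longrightarrow> ob_compose S T \<in> Orth"
  by (rule OrthI) (simp add: ob_compose.rep_eq Orth_disjoint)

text \<open>
  The essential inequality is \<open>T y \<le> (T x)\<^sup>+\<close> for \<open>0 \<le> y \<le> x\<close>.  It is clear if \<open>y\<close> is a component of \<open>x\<close>,
  because the images of disjoint components are disjoint.  Instead of approximating \<open>y\<close> by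
  combinations of components, one binary digit of \<open>y\<close> relative to \<open>x\<close> is enough: on the band where
  \<open>2 y > x\<close>, with \<open>v\<close> the component of \<open>x\<close> there, \<open>2 y\<close> is \<open>v\<close> plus an element below \<open>v\<close>, and off that
  band \<open>2 y\<close> is below the other component \<open>u\<close>.  Thus \<open>2 T y \<le> (T x)\<^sup>+ + T\<^sup>+ x\<close>, and taking the supremum
  over \<open>y\<close> gives \<open>2 T\<^sup>+ x \<le> (T x)\<^sup>+ + T\<^sup>+ x\<close>.
\<close>

lemma Orth_ob_pprt_apply:
  fixes T :: "'a::dedekind_complete_vector_lattice ob_operator"
  assumes T: "T \<in> Orth" and x: "0 \<le> x"
  shows "ob_apply (ob_pprt T) x = pprt (ob_apply T x)"
proof (rule antisym)
  let ?P = "ob_apply (ob_pprt T)"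
  let ?T = "ob_apply T"
  show "pprt (?T x) \<le> ?P x"
    using ob_apply_leD[OF ob_pprt_ge x, of T] ob_apply_nonneg[OF ob_pprt_nonneg x, of T]
    unfolding pprt_def by (rule sup_least)
  have "?T y \<le> (1/2) *\<^sub>R (pprt (?T x) + ?P x)" if y: "0 \<le> y" "y \<le> x" for y
  proof -
    define b where "b = pprt (y + y - x)"
    define C where "C = dcompl {b}"
    have C: "band C" unfolding C_def by (rule band_dcompl)
    obtain u where u: "0 \<le> u" "u \<le> x" "u \<in> C" "x - u \<in> dcompl C"
      by (rule band_decomposition_nonneg[OF C x]) blast
    define v where "v = x - u"
    have v: "0 \<le> v" "v \<le> x" "v \<in> dcompl C" "x = u + v" using u by (simp_all add: v_def)
    have b0: "0 \<le> b" by (simp add: b_def)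
    \<comment> \<open>A positive part below an element of \<open>C\<close> and below one disjoint from \<open>C\<close> vanishes.\<close>
    have zero: "a \<le> 0" if "pprt a \<le> c" "c \<in> C" "pprt a \<le> d" "d \<in> dcompl C" for a c d
    proof -
      have "0 \<le> c" "0 \<le> d" using that by (auto intro: order_trans[OF zero_le_pprt])
      then have "pprt a \<in> C" "pprt a \<in> dcompl C"
        using that by (auto intro: band_solid[OF C] band_solid[OF band_dcompl])
      then show ?thesis using dcompl_Int pprt_eq_0_iff by blast
    qed
    have bdd: "b \<in> dcompl C"
      unfolding C_def using disjoint_dcompl[of b "{b}"] by (auto simp: dcompl_def)
    have "pprt (- (y + y - x)) \<in> C"
      using disjoint_sym[OF disjoint_pprt_pprt_uminus[of "y + y - x"]] by (simp add: C_def dcompl_def b_def)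
    moreover have "pprt (v - (y + y)) \<le> pprt (- (y + y - x))"
      using v(2) by (intro pprt_mono) simp
    moreover have "pprt (v - (y + y)) \<le> v"
    proof -
      have "v - (y + y) \<le> v"
        using diff_left_mono[OF add_nonneg_nonneg[OF y(1) y(1)], of v] by (simp only: diff_zero)
      then show ?thesis using v(1) unfolding pprt_def by (rule sup_least)
    qed
    ultimately have "v - (y + y) \<le> 0" using zero v(3) by blast
    moreover have "b - v \<le> 0"
    proof (rule zero[OF _ u(3) _ bdd])
      have "y + y \<le> x + x" using y(2) by (rule add_mono[OF _ y(2)])
      then have "b \<le> x" using x unfolding b_def pprt_def by (simp add: algebra_simps)
      then show "pprt (b - v) \<le> u" using u(1) by (simp add: pprt_def v_def algebra_simps)
      show "pprt (b - v) \<le> b" using v(1) b0 by (simp add: pprt_def)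
    qed
    ultimately have vy: "v \<le> y + y" and bv: "b \<le> v" by simp_all
    \<comment> \<open>The decomposition of \<open>2 y\<close> is \<open>v + c + b\<close>, where \<open>c\<close> is the part of \<open>2 y\<close> below \<open>u\<close>.\<close>
    define c where "c = inf (y + y) x - v"
    have c0: "0 \<le> c" using vy v(2) by (simp add: c_def)
    have "c \<le> x - v" unfolding c_def by (rule diff_right_mono) simp
    then have cu: "c \<le> u" using v(4) by simp
    have "y + y = v + c + b"
      using inf_add_pprt_diff[of x "y + y"] by (simp add: c_def b_def inf_commute)
    then have "?T y + ?T y = ?T v + ?T c + ?T b" by (metis ob_apply_add)
    also have "\<dots> \<le> pprt (?T v) + ?P u + ?P v"
    proof (intro add_mono)
      show "?T v \<le> pprt (?T v)" by (simp add: pprt_def)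
      show "?T c \<le> ?P u"
        using ob_apply_leD[OF ob_pprt_ge c0] ob_apply_mono[OF ob_pprt_nonneg cu] by (rule order_trans)
      show "?T b \<le> ?P v"
        using ob_apply_leD[OF ob_pprt_ge b0] ob_apply_mono[OF ob_pprt_nonneg bv] by (rule order_trans)
    qed
    also have "\<dots> = pprt (?T v) + ?P x" by (simp add: v(4) ob_apply_add add.assoc)
    also have "\<dots> \<le> pprt (?T x) + ?P x"
    proof (rule add_right_mono)
      have "disjoint u v" using u(3) v(3) by (rule disjoint_dcompl)
      then have "disjoint (?T u) (?T v)" using Orth_disjoint[OF T] disjoint_sym by blast
      then have "pprt (?T x) = pprt (?T u) + pprt (?T v)"
        unfolding v(4) ob_apply_add by (rule pprt_add_disj)
      then show "pprt (?T v) \<le> pprt (?T x)" by simp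
    qed
    finally have "(1/2) *\<^sub>R (?T y + ?T y) \<le> (1/2) *\<^sub>R (pprt (?T x) + ?P x)"
      by (intro scaleR_left_mono) simp_all
    then show ?thesis by (simp flip: scaleR_2)
  qed
  then have "?P x \<le> (1/2) *\<^sub>R (pprt (?T x) + ?P x)"
    unfolding ob_pprt_apply[OF x] by (intro rk_cone_least[OF x])
  then have "2 *\<^sub>R ?P x \<le> 2 *\<^sub>R (1/2) *\<^sub>R (pprt (?T x) + ?P x)"
    by (intro scaleR_left_mono) simp_all
  then show "?P x \<le> pprt (?T x)" by (simp add: scaleR_2)
qed

lemma Orth_abs_apply:
  fixes T :: "'a::dedekind_complete_vector_lattice ob_operator"
  assumes "T \<in> Orth" "0 \<le> x"
  shows "ob_apply \<bar>T\<bar> x = \<bar>ob_apply T x\<bar>"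
  using Orth_ob_pprt_apply[OF assms] Orth_ob_pprt_apply[OF Orth_uminus[OF assms(1)] assms(2)]
    abs_prts[of "ob_apply T x"] pprt_neg[of "ob_apply T x"]
  by (simp add: abs_ob_operator_eq plus_ob_operator.rep_eq uminus_ob_operator.rep_eq)

lemma Orth_sup_apply:
  fixes S T :: "'a::dedekind_complete_vector_lattice ob_operator"
  assumes "S \<in> Orth" "T \<in> Orth" "0 \<le> x"
  shows "ob_apply (sup S T) x = sup (ob_apply S x) (ob_apply T x)"
  using Orth_ob_pprt_apply[OF Orth_diff[OF assms(1,2)] assms(3)]
    add_sup_distrib_left[of "ob_apply T x" "ob_apply S x - ob_apply T x" 0]
  by (simp add: sup_ob_operator_def plus_ob_operator.rep_eq minus_ob_operator.rep_eq pprt_def)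

lemma Orth_inf_apply:
  fixes S T :: "'a::dedekind_complete_vector_lattice ob_operator"
  assumes "S \<in> Orth" "T \<in> Orth" "0 \<le> x"
  shows "ob_apply (inf S T) x = inf (ob_apply S x) (ob_apply T x)"
  using Orth_ob_pprt_apply[OF Orth_diff[OF assms(1,2)] assms(3)]
    inf_add_pprt_diff[of "ob_apply T x" "ob_apply S x"]
  by (simp add: inf_ob_operator_def minus_ob_operator.rep_eq inf_commute algebra_simps)

lemma Orth_solid:
  fixes S T :: "'a::dedekind_complete_vector_lattice ob_operator"
  assumes T: "T \<in> Orth" and le: "\<bar>S\<bar> \<le> \<bar>T\<bar>"
  shows "S \<in> Orth"
proof (rule OrthI)
  fix x y :: 'a assume "disjoint x y"
  then have "disjoint \<bar>x\<bar> y" by (simp add: disjoint_def)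
  then have "disjoint (ob_apply T \<bar>x\<bar>) y" by (rule Orth_disjoint[OF T])
  moreover have "\<bar>ob_apply S x\<bar> \<le> \<bar>ob_apply T \<bar>x\<bar>\<bar>"
    using abs_ob_apply_le[of S x] ob_apply_leD[OF le, of "\<bar>x\<bar>"]
    by (simp add: Orth_abs_apply[OF T])
  ultimately show "disjoint (ob_apply S x) y" by (rule disjoint_mono) simp
qed

section \<open>Pointwise suprema and infima of operators\<close>

text \<open>
  Kantorovich's extension.  The two operators around \<open>f\<close> replace positivity as the reason for the
  extension to be order bounded.
\<close>

lemma operator_cone_extension:
  fixes f :: "'a::vector_lattice \<Rightarrow> 'a" and L U :: "'a ob_operator"
  assumes add: "\<And>x y. 0 \<le> x \<Longrightarrow> 0 \<le> y \<Longrightarrow> f (x + y) = f x + f y"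
    and scale: "\<And>c x. 0 \<le> c \<Longrightarrow> 0 \<le> x \<Longrightarrow> f (c *\<^sub>R x) = c *\<^sub>R f x"
    and lower: "\<And>x. 0 \<le> x \<Longrightarrow> ob_apply L x \<le> f x"
    and upper: "\<And>x. 0 \<le> x \<Longrightarrow> f x \<le> ob_apply U x"
  obtains V where "\<And>x. 0 \<le> x \<Longrightarrow> ob_apply V x = f x"
proof -
  define V where "V x = f (pprt x) - f (pprt (- x))" for x
  have V_diff: "V (a - b) = f a - f b" if "0 \<le> a" "0 \<le> b" for a b
  proof -
    have "pprt (a - b) + b = a + pprt (b - a)"
      using prts[of "a - b"] pprt_neg[of "a - b"] by (simp add: algebra_simps)
    then have "f (pprt (a - b)) + f b = f a + f (pprt (b - a))"
      using that by (simp flip: add)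
    then show ?thesis by (simp add: V_def algebra_simps)
  qed
  have split: "x = pprt x - pprt (- x)" for x :: 'a
    using prts[of x] by (simp add: pprt_neg)
  have V_add: "V (x + y) = V x + V y" for x y
  proof -
    have "x + y = (pprt x + pprt y) - (pprt (- x) + pprt (- y))"
      using arg_cong2[OF split[of x] split[of y], of "(+)"] by (simp add: algebra_simps)
    then have "V (x + y) = f (pprt x + pprt y) - f (pprt (- x) + pprt (- y))"
      by (metis V_diff add_nonneg_nonneg zero_le_pprt)
    then show ?thesis by (simp add: add V_def)
  qed
  have V_pos: "V (c *\<^sub>R x) = c *\<^sub>R V x" if "0 \<le> c" for c x
  proof -
    have "c *\<^sub>R x = c *\<^sub>R pprt x - c *\<^sub>R pprt (- x)"
      using split[of x] by (simp flip: scaleR_diff_right)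
    then have "V (c *\<^sub>R x) = f (c *\<^sub>R pprt x) - f (c *\<^sub>R pprt (- x))"
      using that by (metis V_diff scaleR_nonneg_nonneg zero_le_pprt)
    then show ?thesis using that by (simp add: scale V_def scaleR_diff_right)
  qed
  have V_neg: "V (- x) = - V x" for x by (simp add: V_def)
  have V_scale: "V (c *\<^sub>R x) = c *\<^sub>R V x" for c x
  proof (cases "0 \<le> c")
    case False
    then have "V ((- c) *\<^sub>R x) = (- c) *\<^sub>R V x" by (intro V_pos) simp
    then show ?thesis using V_neg[of "c *\<^sub>R x"] by simp
  qed (rule V_pos)
  have V_linear: "linear V" using V_add V_scale by (rule linearI)
  have V_eq: "V x = f x" if "0 \<le> x" for x
  proof -
    have "f 0 = 0" using scale[of 0 0] by simp
    then show ?thesis using that by (simp add: V_def)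
  qed
  have "order_bounded_operator V"
  proof (rule order_bounded_operatorI[OF V_linear])
    fix A :: "'a set" assume "order_bounded A"
    then obtain a b where ab: "A \<subseteq> {a..b}" unfolding order_bounded_def by blast
    have I: "order_bounded {0..b - a}" unfolding order_bounded_def by blast
    obtain l where l: "\<forall>x\<in>{0..b - a}. l \<le> ob_apply L x"
      using order_bounded_ob_apply[OF I] unfolding order_bounded_image_iff by blast
    obtain u where u: "\<forall>x\<in>{0..b - a}. ob_apply U x \<le> u"
      using order_bounded_ob_apply[OF I] unfolding order_bounded_image_iff by blast
    have "V a + l \<le> V x \<and> V x \<le> V a + u" if "x \<in> A" for x
    proof -
      have x: "x - a \<in> {0..b - a}" using ab that by auto
      have "V x = V a + f (x - a)"
        using V_eq[of "x - a"] x by (simp add: linear_diff[OF V_linear] algebra_simps)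
      moreover have "l \<le> f (x - a)" using l x lower[of "x - a"] by (auto intro: order_trans)
      moreover have "f (x - a) \<le> u" using u x upper[of "x - a"] by (auto intro: order_trans)
      ultimately show ?thesis by simp
    qed
    then show "order_bounded (V ` A)" unfolding order_bounded_image_iff by blast
  qed
  then have "ob_apply (Abs_ob_operator V) = V" by (simp add: Abs_ob_operator_inverse)
  then show ?thesis using V_eq by (intro that[of "Abs_ob_operator V"]) simp
qed

text \<open>
  Pointwise suprema are always subadditive; superadditivity has to be assumed.  It holds both for
  upwards directed sets and for sets of orthomorphisms, which need not be directed.
\<close>

lemma operator_Sup_pointwise:
  fixes F :: "'a::dedekind_complete_vector_lattice ob_operator set"
  assumes ne: "F \<noteq> {}" and upper: "\<And>T. T \<in> F \<Longrightarrow> T \<le> U"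
    and superadd: "\<And>S T x y. S \<in> F \<Longrightarrow> T \<in> F \<Longrightarrow> 0 \<le> x \<Longrightarrow> 0 \<le> y \<Longrightarrow>
      ob_apply S x + ob_apply T y \<le> (SUP R\<in>F. ob_apply R (x + y))"
  obtains V where "\<And>x. 0 \<le> x \<Longrightarrow> ob_apply V x = (SUP R\<in>F. ob_apply R x)"
proof -
  let ?f = "\<lambda>x. SUP R\<in>F. ob_apply R x"
  obtain T0 where T0: "T0 \<in> F" using ne by blast
  have bdd: "bdd_above ((\<lambda>R. ob_apply R x) ` F)" if "0 \<le> x" for x
    using ob_apply_leD[OF upper that] by (auto simp: bdd_above_def)
  have ub: "ob_apply R x \<le> ?f x" if "0 \<le> x" "R \<in> F" for R x
    using that by (intro cSUP_upper bdd)
  have least: "?f x \<le> v" if "\<And>R. R \<in> F \<Longrightarrow> ob_apply R x \<le> v" for x v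
    using ne that by (rule cSUP_least)
  have scale_le: "?f (c *\<^sub>R x) \<le> c *\<^sub>R ?f x" if "0 < c" "0 \<le> x" for c x
    using that ub by (intro least) (simp add: ob_apply_scaleR scaleR_left_mono)
  show ?thesis
  proof (rule operator_cone_extension[of ?f T0 U])
    fix x y :: 'a assume xy: "0 \<le> x" "0 \<le> y"
    show "?f (x + y) = ?f x + ?f y"
    proof (rule antisym)
      show "?f (x + y) \<le> ?f x + ?f y"
        using xy by (intro least) (simp add: ob_apply_add add_mono ub)
      have "?f x \<le> ?f (x + y) - ?f y"
      proof (rule least)
        fix S assume S: "S \<in> F"
        have "?f y \<le> ?f (x + y) - ob_apply S x"
          using superadd[OF S _ xy] by (intro least) (simp add: algebra_simps)
        then show "ob_apply S x \<le> ?f (x + y) - ?f y" by (simp add: algebra_simps)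
      qed
      then show "?f x + ?f y \<le> ?f (x + y)" by (simp add: algebra_simps)
    qed
  next
    fix c :: real and x :: 'a assume c: "0 \<le> c" and x: "0 \<le> x"
    show "?f (c *\<^sub>R x) = c *\<^sub>R ?f x"
    proof (cases "c = 0")
      case True
      then show ?thesis using ne by simp
    next
      case False
      then have c: "0 < c" using c by simp
      have "?f (inverse c *\<^sub>R c *\<^sub>R x) \<le> inverse c *\<^sub>R ?f (c *\<^sub>R x)"
        using c x by (intro scale_le) (simp_all add: scaleR_nonneg_nonneg)
      then have "c *\<^sub>R ?f x \<le> c *\<^sub>R inverse c *\<^sub>R ?f (c *\<^sub>R x)"
        using c by (intro scaleR_left_mono) simp_all
      then have "c *\<^sub>R ?f x \<le> ?f (c *\<^sub>R x)" using c by simp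
      then show ?thesis by (intro antisym scale_le[OF c x])
    qed
  next
    fix x :: 'a assume x: "0 \<le> x"
    show "ob_apply T0 x \<le> ?f x" using x T0 by (rule ub)
    show "?f x \<le> ob_apply U x" using ob_apply_leD[OF upper x] by (rule least)
  qed (rule that)
qed

text \<open>
  For downwards directed sets of operators infima are pointwise.  The infimum is obtained as
  \<open>K0 - V\<close>, with \<open>V\<close> the pointwise supremum of the differences \<open>K0 - K\<close>.
\<close>

lemma operator_inf_zero_pointwise:
  fixes H :: "'a::dedekind_complete_vector_lattice ob_operator set"
  assumes ne: "H \<noteq> {}" and pos: "\<And>K. K \<in> H \<Longrightarrow> 0 \<le> K"
    and closed: "\<And>K L. K \<in> H \<Longrightarrow> L \<in> H \<Longrightarrow> inf K L \<in> H"
    and glb: "\<And>W. (\<And>K. K \<in> H \<Longrightarrow> W \<le> K) \<Longrightarrow> W \<le> 0"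
    and x: "0 \<le> x" and w: "\<And>K. K \<in> H \<Longrightarrow> w \<le> ob_apply K x"
  shows "w \<le> 0"
proof -
  obtain K0 where K0: "K0 \<in> H" using ne by blast
  let ?F = "(\<lambda>K. K0 - K) ` H"
  have le: "T \<le> K0" if "T \<in> ?F" for T using that pos by auto
  have ub: "ob_apply (K0 - K) z \<le> (SUP R\<in>?F. ob_apply R z)" if "0 \<le> z" "K \<in> H" for K z
    using ob_apply_leD[OF le that(1)] that(2)
    by (intro cSUP_upper) (auto simp: bdd_above_def)
  obtain V where V: "\<And>z. 0 \<le> z \<Longrightarrow> ob_apply V z = (SUP R\<in>?F. ob_apply R z)"
  proof (rule operator_Sup_pointwise[of ?F K0])
    show "?F \<noteq> {}" using ne by blast
    show "T \<le> K0" if "T \<in> ?F" for T using that by (rule le)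
    fix S T and y z :: 'a assume ST: "S \<in> ?F" "T \<in> ?F" and yz: "0 \<le> y" "0 \<le> z"
    then obtain K L where KL: "K \<in> H" "L \<in> H" "S = K0 - K" "T = K0 - L" by blast
    let ?R = "K0 - inf K L"
    have "ob_apply S y + ob_apply T z \<le> ob_apply ?R y + ob_apply ?R z"
      using yz KL by (intro add_mono ob_apply_leD) simp_all
    also have "\<dots> = ob_apply ?R (y + z)" by (simp add: ob_apply_add)
    also have "\<dots> \<le> (SUP R\<in>?F. ob_apply R (y + z))"
      using yz KL by (intro ub closed add_nonneg_nonneg)
    finally show "ob_apply S y + ob_apply T z \<le> (SUP R\<in>?F. ob_apply R (y + z))" .
  qed (rule that)
  have "K0 - V \<le> 0"
  proof (rule glb)
    fix K assume K: "K \<in> H"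
    show "K0 - V \<le> K"
    proof (rule ob_operator_leI)
      fix z :: 'a assume z: "0 \<le> z"
      show "ob_apply (K0 - V) z \<le> ob_apply K z"
        using ub[OF z K] V[OF z] by (simp add: minus_ob_operator.rep_eq algebra_simps)
    qed
  qed
  then have "ob_apply K0 x \<le> ob_apply V x" by (intro ob_apply_leD x) simp
  also have "\<dots> \<le> ob_apply K0 x - w"
    unfolding V[OF x] using ne w by (intro cSUP_least) (auto simp: minus_ob_operator.rep_eq)
  finally show ?thesis by simp
qed

section \<open>Limits of nets of orthomorphisms\<close>

text \<open>
  If \<open>x\<close> is disjoint from \<open>y\<close>, then so is \<open>F a x\<close>; hence what \<open>T x\<close> has in common with \<open>y\<close> is already
  below \<open>\<bar>F a x - T x\<bar>\<close>.
\<close>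

lemma Orth_SUO_closed:
  fixes F :: "'i \<Rightarrow> 'a::dedekind_complete_vector_lattice ob_operator"
  assumes A: "directed_on A r" and F: "\<And>a. a \<in> A \<Longrightarrow> F a \<in> Orth" and lim: "SUO_tendsto A r F T"
  shows "T \<in> Orth"
proof (rule OrthI)
  fix x y :: 'a assume xy: "disjoint x y"
  let ?w = "inf \<bar>ob_apply T x\<bar> \<bar>y\<bar>"
  have "?w \<le> 0"
  proof (rule uo_tendsto_limit_le)
    show "uo_tendsto A r (\<lambda>a. ob_apply (F a) x) (ob_apply T x)"
      using lim by (simp add: SUO_tendsto_def)
    show "0 \<le> \<bar>y\<bar>" by simp
    fix h assume "dominates A r (\<lambda>a. inf \<bar>ob_apply (F a) x - ob_apply T x\<bar> \<bar>y\<bar>) h"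
    then obtain a where a: "a \<in> A" "inf \<bar>ob_apply (F a) x - ob_apply T x\<bar> \<bar>y\<bar> \<le> h"
      by (rule dominates_point[OF A])
    have "\<bar>ob_apply T x\<bar> \<le> \<bar>ob_apply (F a) x - ob_apply T x\<bar> + \<bar>ob_apply (F a) x\<bar>"
      using abs_triangle_ineq4[of "ob_apply (F a) x" "ob_apply (F a) x - ob_apply T x"]
      by (simp add: add.commute)
    then have "?w \<le> inf (\<bar>ob_apply (F a) x - ob_apply T x\<bar> + \<bar>ob_apply (F a) x\<bar>) \<bar>y\<bar>"
      by (rule inf_mono) simp
    also have "\<dots> \<le> inf \<bar>ob_apply (F a) x - ob_apply T x\<bar> \<bar>y\<bar> + inf \<bar>ob_apply (F a) x\<bar> \<bar>y\<bar>"
      by (intro inf_add_le) simp_all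
    also have "inf \<bar>ob_apply (F a) x\<bar> \<bar>y\<bar> = 0"
      using Orth_disjoint[OF F[OF a(1)] xy] by (simp add: disjoint_def)
    finally have "?w \<le> inf \<bar>ob_apply (F a) x - ob_apply T x\<bar> \<bar>y\<bar>" by (simp only: add_0_right)
    then show "?w \<le> 0 + h" unfolding add_0_left using a(2) by (rule order_trans)
  qed
  then show "disjoint (ob_apply T x) y" by (rule disjointI)
qed

lemma band_projection:
  fixes B :: "'a::dedekind_complete_vector_lattice set"
  assumes B: "band B"
  obtains P where "\<And>x. ob_apply P x \<in> B" "\<And>x. x - ob_apply P x \<in> dcompl B"
    "\<And>x. 0 \<le> x \<Longrightarrow> 0 \<le> ob_apply P x" "\<And>x. 0 \<le> x \<Longrightarrow> ob_apply P x \<le> x"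
proof -
  obtain p where p: "\<And>x. p x \<in> B" "\<And>x. x - p x \<in> dcompl B"
    using band_decomposition[OF B] by metis
  have unique: "p x = u" if "u \<in> B" "x - u \<in> dcompl B" for x u
  proof -
    have "p x - u \<in> B" using band_diff[OF B] p(1) that(1) .
    moreover have "(x - u) - (x - p x) \<in> dcompl B" using band_diff[OF band_dcompl] that(2) p(2) .
    then have "p x - u \<in> dcompl B" by simp
    ultimately have "p x - u = 0" by (rule dcompl_Int)
    then show ?thesis by simp
  qed
  have pos: "0 \<le> p x \<and> p x \<le> x" if x: "0 \<le> x" for x
  proof -
    obtain u where u: "0 \<le> u" "u \<le> x" "u \<in> B" "x - u \<in> dcompl B"
      by (rule band_decomposition_nonneg[OF B x]) blast
    then show ?thesis using unique[of u x] by simp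
  qed
  have lin: "linear p"
  proof (rule linearI)
    fix x y :: 'a and c :: real
    have "(x - p x) + (y - p y) \<in> dcompl B" by (intro band_add[OF band_dcompl] p)
    then show "p (x + y) = p x + p y"
      by (intro unique band_add[OF B] p) (simp add: algebra_simps)
    have "c *\<^sub>R (x - p x) \<in> dcompl B" by (intro band_scaleR[OF band_dcompl] p)
    then show "p (c *\<^sub>R x) = c *\<^sub>R p x"
      by (intro unique band_scaleR[OF B] p) (simp add: algebra_simps)
  qed
  have "order_bounded_operator p"
  proof (rule order_bounded_operatorI[OF lin])
    fix A :: "'a set" assume "order_bounded A"
    then obtain a b where ab: "A \<subseteq> {a..b}" unfolding order_bounded_def by blast
    have "p a \<le> p x \<and> p x \<le> p b" if "x \<in> A" for x
      using pos[of "x - a"] pos[of "b - x"] ab that by (auto simp: linear_diff[OF lin])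
    then show "order_bounded (p ` A)" unfolding order_bounded_image_iff by blast
  qed
  then have "ob_apply (Abs_ob_operator p) = p" by (simp add: Abs_ob_operator_inverse)
  then show ?thesis using p pos by (intro that[of "Abs_ob_operator p"]) simp_all
qed

text \<open>
  On the range of \<open>P\<close>, \<open>\<bar>F a\<bar>\<close> stays inside \<open>B\<close> and \<open>U\<close> maps into the disjoint complement of \<open>B\<close>, while \<open>U\<close>
  vanishes on the kernel of \<open>P\<close>.  So \<open>\<bar>F a\<bar>\<close> and \<open>U\<close> are disjoint operators, \<open>U \<le> \<bar>F a - T\<bar>\<close> follows
  from \<open>U \<le> \<bar>T\<bar>\<close>, and the limit forces \<open>U = 0\<close>.
\<close>

lemma Orth_uo_closed:
  fixes F :: "'i \<Rightarrow> 'a::dedekind_complete_vector_lattice ob_operator"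
  assumes A: "directed_on A r" and F: "\<And>a. a \<in> A \<Longrightarrow> F a \<in> Orth" and lim: "uo_tendsto A r F T"
  shows "T \<in> Orth"
  unfolding Orth_def
proof (intro CollectI allI impI image_subsetI)
  fix B :: "'a set" and x assume B: "band B" and x: "x \<in> B"
  obtain P where P: "\<And>x. ob_apply P x \<in> B" "\<And>x. x - ob_apply P x \<in> dcompl B"
    "\<And>x. 0 \<le> x \<Longrightarrow> 0 \<le> ob_apply P x" "\<And>x. 0 \<le> x \<Longrightarrow> ob_apply P x \<le> x"
    using band_projection[OF B] by blast
  have P_id: "ob_apply P v = v" if "v \<in> B" for v
    using dcompl_Int[OF band_diff[OF B that P(1)] P(2)] by simp
  \<comment> \<open>\<open>U\<close> is \<open>(1 - P) \<bar>T\<bar> P\<close>.\<close>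
  define U where "U = ob_compose \<bar>T\<bar> P - ob_compose P (ob_compose \<bar>T\<bar> P)"
  have U_apply: "ob_apply U v = ob_apply \<bar>T\<bar> (ob_apply P v) - ob_apply P (ob_apply \<bar>T\<bar> (ob_apply P v))" for v
    by (simp add: U_def minus_ob_operator.rep_eq ob_compose.rep_eq)
  have U_dcompl: "ob_apply U v \<in> dcompl B" for v
    unfolding U_apply by (rule P(2))
  have U0: "0 \<le> U"
    by (rule ob_operator_leI)
      (simp add: U_apply zero_ob_operator.rep_eq P ob_apply_nonneg)
  have UT: "U \<le> \<bar>T\<bar>"
  proof (rule ob_operator_leI)
    fix v :: 'a assume v: "0 \<le> v"
    have "ob_apply U v \<le> ob_apply \<bar>T\<bar> (ob_apply P v)"
      using P(3)[OF v] by (simp add: U_apply P(3) ob_apply_nonneg)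
    also have "\<dots> \<le> ob_apply \<bar>T\<bar> v" using P(4)[OF v] by (intro ob_apply_mono) simp_all
    finally show "ob_apply U v \<le> ob_apply \<bar>T\<bar> v" .
  qed
  have disj: "inf \<bar>F a\<bar> U \<le> 0" if a: "a \<in> A" for a
  proof (rule ob_operator_leI)
    fix v :: 'a assume v: "0 \<le> v"
    let ?K = "inf \<bar>F a\<bar> U" and ?u = "ob_apply P v"
    have u: "0 \<le> ?u" "?u \<in> B" "0 \<le> v - ?u" using P v by simp_all
    have K0: "0 \<le> ?K" using U0 by simp
    have le: "ob_apply ?K ?u \<le> \<bar>ob_apply (F a) ?u\<bar>" "ob_apply ?K ?u \<le> ob_apply U ?u"
      using ob_apply_inf_le[OF u(1), of "\<bar>F a\<bar>" U] Orth_abs_apply[OF F[OF a] u(1)] by simp_all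
    have "ob_apply (F a) ?u \<in> B" using F[OF a] B u(2) unfolding Orth_def by blast
    then have "ob_apply ?K ?u \<in> B"
      by (rule band_solid[OF B]) (use le(1) ob_apply_nonneg[OF K0 u(1)] in simp)
    moreover have "ob_apply ?K ?u \<in> dcompl B"
      by (rule band_solid[OF band_dcompl U_dcompl[of ?u]])
        (use le(2) ob_apply_nonneg[OF K0 u(1)] ob_apply_nonneg[OF U0 u(1)] in simp)
    ultimately have 1: "ob_apply ?K ?u = 0" by (rule dcompl_Int)
    have "ob_apply ?K (v - ?u) \<le> ob_apply U (v - ?u)" by (rule ob_apply_leD[OF inf_le2 u(3)])
    also have "\<dots> = 0" by (simp add: U_apply ob_apply_diff P_id[OF u(2)])
    finally show "ob_apply ?K v \<le> ob_apply 0 v"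
      using 1 by (simp add: ob_apply_diff zero_ob_operator.rep_eq)
  qed
  have "U \<le> 0"
  proof (rule uo_tendsto_limit_le[OF lim U0])
    fix h assume "dominates A r (\<lambda>a. inf \<bar>F a - T\<bar> U) h"
    then obtain a where a: "a \<in> A" "inf \<bar>F a - T\<bar> U \<le> h" by (rule dominates_point[OF A])
    have "\<bar>T\<bar> \<le> \<bar>F a - T\<bar> + \<bar>F a\<bar>"
      using abs_triangle_ineq4[of "F a" "F a - T"] by (simp add: add.commute)
    with UT have "U \<le> inf (\<bar>F a - T\<bar> + \<bar>F a\<bar>) U" by simp
    also have "\<dots> \<le> inf \<bar>F a - T\<bar> U + inf \<bar>F a\<bar> U" using U0 by (intro inf_add_le) simp_all
    also have "\<dots> \<le> h + 0" by (intro add_mono a disj)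
    finally show "U \<le> 0 + h" by simp
  qed
  then have "ob_apply U \<bar>x\<bar> = 0"
    using U0 by (metis abs_ge_zero antisym ob_apply_leD ob_apply_nonneg zero_ob_operator.rep_eq)
  moreover have "ob_apply P \<bar>x\<bar> = \<bar>x\<bar>" by (rule P_id[OF band_solid[OF B x]]) simp
  ultimately have "ob_apply \<bar>T\<bar> \<bar>x\<bar> = ob_apply P (ob_apply \<bar>T\<bar> \<bar>x\<bar>)" by (simp add: U_apply)
  then have "ob_apply \<bar>T\<bar> \<bar>x\<bar> \<in> B" using P(1) by metis
  then show "ob_apply T x \<in> B"
    by (rule band_solid[OF B]) (rule order_trans[OF abs_ob_apply_le abs_ge_self])
qed

lift_definition ob_id :: "'a::vector_lattice ob_operator" is "\<lambda>x. x"
  by (rule order_bounded_operatorI) (simp_all add: linear_iff)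

lemma ob_id_Orth: "ob_id \<in> Orth"
  by (simp add: Orth_def ob_id.rep_eq)

text \<open>
  Cutting off \<open>\<bar>F a - T\<bar>\<close> with the identity controls \<open>inf \<bar>x\<bar> \<bar>F a x - T x\<bar>\<close>.  Here the eventual upper
  bounds are operators whose infimum is \<open>0\<close>, and they can be evaluated at \<open>\<bar>x\<bar>\<close> because they form a
  downwards directed set.
\<close>

lemma Orth_uo_imp_SUO:
  fixes F :: "'i \<Rightarrow> 'a::dedekind_complete_vector_lattice ob_operator"
  assumes A: "directed_on A r" and F: "\<And>a. a \<in> A \<Longrightarrow> F a \<in> Orth" and T: "T \<in> Orth"
    and lim: "uo_tendsto A r F T"
  shows "SUO_tendsto A r F T"
  unfolding SUO_tendsto_def
proof (intro allI uo_tendstoI[OF A])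
  fix x y w :: 'a
  let ?z = "\<lambda>a. inf \<bar>ob_apply (F a) x - ob_apply T x\<bar> y"
  assume y: "0 \<le> y" and w: "0 \<le> w" and below: "below_limsup A r ?z w"
  obtain a0 where a0: "a0 \<in> A" using directed_onD(1)[OF A] by blast
  have bound: "dominates A r ?z y" by (rule dominatesI[OF a0]) simp
  define H where "H = {K. dominates A r (\<lambda>a. inf \<bar>F a - T\<bar> ob_id) K}"
  have id0: "(0 :: 'a ob_operator) \<le> ob_id"
    by (rule ob_operator_leI) (simp add: ob_id.rep_eq zero_ob_operator.rep_eq)
  have "inf \<bar>x\<bar> w \<le> 0"
  proof (rule operator_inf_zero_pointwise[of H "\<bar>x\<bar>"])
    have "ob_id \<in> H" by (simp add: H_def dominatesI[OF a0])
    then show "H \<noteq> {}" by blast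
    show "0 \<le> K" if "K \<in> H" for K
    proof -
      have "dominates A r (\<lambda>a. inf \<bar>F a - T\<bar> ob_id) K" using that by (simp add: H_def)
      then obtain a where "inf \<bar>F a - T\<bar> ob_id \<le> K" by (rule dominates_point[OF A])
      moreover have "0 \<le> inf \<bar>F a - T\<bar> ob_id" using id0 by simp
      ultimately show ?thesis by (rule order_trans[rotated])
    qed
    show "inf K L \<in> H" if "K \<in> H" "L \<in> H" for K L
      using that dominates_inf[OF A] by (simp add: H_def)
    show "W \<le> 0" if "\<And>K. K \<in> H \<Longrightarrow> W \<le> K" for W
      by (rule uo_tendsto_limit_le[OF lim id0]) (simp add: H_def that)
    show "0 \<le> \<bar>x\<bar>" by simp
    fix K assume "K \<in> H"
    then have "dominates A r (\<lambda>a. inf \<bar>F a - T\<bar> ob_id) K" by (simp add: H_def)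
    then obtain a1 where a1: "a1 \<in> A" "\<And>a. (a1, a) \<in> r \<Longrightarrow> inf \<bar>F a - T\<bar> ob_id \<le> K"
      by (rule dominatesE) blast
    show "inf \<bar>x\<bar> w \<le> ob_apply K \<bar>x\<bar>"
    proof (rule below_limsup_inf[OF A below bound], rule dominatesI[OF a1(1)])
      fix a assume a: "(a1, a) \<in> r"
      then have D: "F a - T \<in> Orth" using F T directed_onD(4)[OF A a] Orth_diff by blast
      then have "\<bar>F a - T\<bar> \<in> Orth" by (rule Orth_solid) simp
      then have "ob_apply (inf \<bar>F a - T\<bar> ob_id) \<bar>x\<bar> = inf (ob_apply \<bar>F a - T\<bar> \<bar>x\<bar>) \<bar>x\<bar>"
        using Orth_inf_apply[OF _ ob_id_Orth, of "\<bar>F a - T\<bar>" "\<bar>x\<bar>"] by (simp add: ob_id.rep_eq)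
      moreover have "?z a \<le> ob_apply \<bar>F a - T\<bar> \<bar>x\<bar>"
        using abs_ob_apply_le[of "F a - T" x]
        by (intro le_infI1) (simp add: minus_ob_operator.rep_eq)
      ultimately have "inf \<bar>x\<bar> (?z a) \<le> ob_apply (inf \<bar>F a - T\<bar> ob_id) \<bar>x\<bar>"
        by (simp add: le_infI2)
      also have "\<dots> \<le> ob_apply K \<bar>x\<bar>" by (intro ob_apply_leD a1(2)[OF a]) simp
      finally show "inf \<bar>x\<bar> (?z a) \<le> ob_apply K \<bar>x\<bar>" .
    qed
  qed
  then show "w = 0"
  proof (rule below_limsup_disjoint_eq_0[OF A below w bound])
    show "0 \<le> ?z a" for a using y by simp
    fix a v assume a: "a \<in> A" and v: "disjoint x v"
    have "disjoint (ob_apply (F a) x - ob_apply T x) v"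
      by (intro disjoint_diff Orth_disjoint[OF F[OF a] v] Orth_disjoint[OF T v])
    then show "disjoint (?z a) v" by (rule disjoint_mono) (use y in simp_all)
  qed
qed

text \<open>
  The operators \<open>inf \<bar>F a - T\<bar> U\<close> are orthomorphisms even if \<open>U\<close> is not, so the supremum \<open>V\<close> of a tail is
  pointwise.  An eventual upper bound at \<open>x\<close> of the net in the space therefore bounds \<open>V x\<close>.
\<close>

lemma Orth_SUO_imp_uo:
  fixes F :: "'i \<Rightarrow> 'a::dedekind_complete_vector_lattice ob_operator"
  assumes A: "directed_on A r" and F: "\<And>a. a \<in> A \<Longrightarrow> F a \<in> Orth" and T: "T \<in> Orth"
    and lim: "SUO_tendsto A r F T"
  shows "uo_tendsto A r F T"
proof (rule uo_tendstoI[OF A])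
  fix U W :: "'a ob_operator"
  assume U: "0 \<le> U" and W: "0 \<le> W" and below: "below_limsup A r (\<lambda>a. inf \<bar>F a - T\<bar> U) W"
  have "W \<le> 0"
  proof (rule ob_operator_leI)
    fix x :: 'a assume x: "0 \<le> x"
    have "ob_apply W x \<le> 0"
    proof (rule uo_tendsto_limit_le)
      show "uo_tendsto A r (\<lambda>a. ob_apply (F a) x) (ob_apply T x)"
        using lim by (simp add: SUO_tendsto_def)
      show "0 \<le> ob_apply U x" using U x by (rule ob_apply_nonneg)
      fix h assume "dominates A r (\<lambda>a. inf \<bar>ob_apply (F a) x - ob_apply T x\<bar> (ob_apply U x)) h"
      then obtain a0 where a0: "a0 \<in> A"
        "\<And>a. (a0, a) \<in> r \<Longrightarrow> inf \<bar>ob_apply (F a) x - ob_apply T x\<bar> (ob_apply U x) \<le> h"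
        by (rule dominatesE) blast
      define G where "G = (\<lambda>a. inf \<bar>F a - T\<bar> U) ` {a. (a0, a) \<in> r}"
      have tail: "F a - T \<in> Orth" if "(a0, a) \<in> r" for a
        using F T directed_onD(4)[OF A that] Orth_diff by blast
      have G_le: "R \<le> U" if "R \<in> G" for R using that by (auto simp: G_def)
      have G_Orth: "R \<in> Orth" if R: "R \<in> G" for R
      proof -
        obtain a where a: "(a0, a) \<in> r" "R = inf \<bar>F a - T\<bar> U" using R by (auto simp: G_def)
        show ?thesis by (rule Orth_solid[OF tail[OF a(1)]]) (use U in \<open>simp add: a(2)\<close>)
      qed
      have G_ne: "G \<noteq> {}" using directed_onD(2)[OF A a0(1)] by (auto simp: G_def)
      have ub: "ob_apply R v \<le> (SUP R\<in>G. ob_apply R v)" if "0 \<le> v" "R \<in> G" for R v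
        using ob_apply_leD[OF G_le that(1)] that(2) by (intro cSUP_upper) (auto simp: bdd_above_def)
      obtain V where V: "\<And>v. 0 \<le> v \<Longrightarrow> ob_apply V v = (SUP R\<in>G. ob_apply R v)"
      proof (rule operator_Sup_pointwise[OF G_ne, of U])
        show "R \<le> U" if "R \<in> G" for R using that by (rule G_le)
        fix Q R and u v :: 'a assume QR: "Q \<in> G" "R \<in> G" and uv: "0 \<le> u" "0 \<le> v"
        then have uv': "0 \<le> u + v" by simp
        have "ob_apply Q u + ob_apply R v \<le> ob_apply (sup Q R) u + ob_apply (sup Q R) v"
          using uv by (intro add_mono ob_apply_leD) simp_all
        also have "\<dots> = sup (ob_apply Q (u + v)) (ob_apply R (u + v))"
          using Orth_sup_apply[OF G_Orth[OF QR(1)] G_Orth[OF QR(2)] uv']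
          by (simp add: ob_apply_add)
        also have "\<dots> \<le> (SUP R\<in>G. ob_apply R (u + v))"
          using ub[OF uv'] QR by (intro sup_least)
        finally show "ob_apply Q u + ob_apply R v \<le> (SUP R\<in>G. ob_apply R (u + v))" .
      qed (rule that)
      have "dominates A r (\<lambda>a. inf \<bar>F a - T\<bar> U) V"
      proof (rule dominatesI[OF a0(1)], rule ob_operator_leI)
        fix a and v :: 'a assume "(a0, a) \<in> r" and v: "0 \<le> v"
        then show "ob_apply (inf \<bar>F a - T\<bar> U) v \<le> ob_apply V v"
          unfolding V[OF v] by (intro ub) (auto simp: G_def)
      qed
      then have "W \<le> V" using below by (simp add: below_limsup_def)
      then have "ob_apply W x \<le> ob_apply V x" using x by (rule ob_apply_leD)
      also have "\<dots> \<le> h"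
        unfolding V[OF x]
      proof (rule cSUP_least[OF G_ne])
        fix R assume "R \<in> G"
        then obtain a where a: "(a0, a) \<in> r" "R = inf \<bar>F a - T\<bar> U" by (auto simp: G_def)
        have "ob_apply R x \<le> inf (ob_apply \<bar>F a - T\<bar> x) (ob_apply U x)"
          unfolding a(2) by (rule ob_apply_inf_le[OF x])
        also have "\<dots> \<le> h"
          using a0(2)[OF a(1)] by (simp add: Orth_abs_apply[OF tail[OF a(1)] x] minus_ob_operator.rep_eq)
        finally show "ob_apply R x \<le> h" .
      qed
      finally show "ob_apply W x \<le> 0 + h" by simp
    qed
    then show "ob_apply W x \<le> ob_apply 0 x" by (simp add: zero_ob_operator.rep_eq)
  qed
  then show "W = 0" using W by (rule antisym)
qed

section \<open>Products of nets of orthomorphisms\<close>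

text \<open>
  Bookkeeping for the product estimate: under the infimum with \<open>v\<close> a summand disjoint from \<open>v\<close>
  disappears, and of the others only \<open>G\<close> is used without the cut-off at \<open>y\<close>.
\<close>

lemma inf_le_of_disjoint_part:
  fixes G k m n y v :: "'a::vector_lattice"
  assumes G: "0 \<le> G" and k: "0 \<le> k" and m: "0 \<le> m" and n: "0 \<le> n"
    and y: "0 \<le> y" and v: "0 \<le> v" and nv: "inf n v = 0"
  shows "inf v (inf (G + k + m + n) y) \<le> G + inf k y + inf m y"
proof -
  let ?c = "inf y v"
  have c: "0 \<le> ?c" using y v by simp
  have "inf (G + k + m + n) ?c \<le> inf (G + k + m) ?c + inf n ?c"
    using G k m n c by (intro inf_add_le) simp_all
  also have "inf (G + k + m) ?c \<le> inf (G + k) ?c + inf m ?c"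
    using G k m c by (intro inf_add_le) simp_all
  also have "inf (G + k) ?c \<le> inf G ?c + inf k ?c"
    using G k c by (intro inf_add_le)
  also have "inf G ?c + inf k ?c + inf m ?c + inf n ?c \<le> G + inf k y + inf m y + inf n v"
    by (intro add_mono inf_mono) simp_all
  finally show ?thesis using nv by (simp add: inf.assoc inf_commute inf.left_commute)
qed

text \<open>
  Let \<open>w\<close> be below the limit superior.  For \<open>c = 1 / N\<close> the claim is \<open>inf \<bar>x\<bar> w \<le> c \<bar>S\<bar> \<bar>x\<bar>\<close>; the Archimedean
  property then gives \<open>inf \<bar>x\<bar> w = 0\<close>, which suffices as everything happens in the band generated
  by \<open>x\<close>.  Let \<open>h\<close> eventually dominate \<open>inf \<bar>G b x - T x\<bar> (c \<bar>x\<bar>)\<close>.  On the band generated by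
  \<open>q = (c \<bar>x\<bar> - h)\<^sup>+\<close> then eventually \<open>\<bar>G b x - T x\<bar> \<le> c \<bar>x\<bar>\<close>, since the excess of the left hand side is
  disjoint from \<open>q\<close>, and stays so after \<open>F a\<close> has been applied to it.  On the rest of the space \<open>\<bar>x\<bar>\<close> is
  at most \<open>N h\<close>, an error that disappears in the limit.
\<close>

lemma Orth_SUO_compose:
  fixes F :: "'i \<Rightarrow> 'a::dedekind_complete_vector_lattice ob_operator" and G :: "'j \<Rightarrow> 'a ob_operator"
  assumes A: "directed_on A r" and F: "\<And>a. a \<in> A \<Longrightarrow> F a \<in> Orth" and S: "S \<in> Orth"
    and F_lim: "SUO_tendsto A r F S"
    and B: "directed_on B s" and G: "\<And>b. b \<in> B \<Longrightarrow> G b \<in> Orth" and T: "T \<in> Orth"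
    and G_lim: "SUO_tendsto B s G T"
  shows "SUO_tendsto (A \<times> B) (product_order r s) (\<lambda>(a, b). ob_compose (F a) (G b)) (ob_compose S T)"
  unfolding SUO_tendsto_def
proof (intro allI uo_tendstoI[OF directed_on_product_order[OF A B]])
  fix x y w :: 'a
  let ?r = "product_order r s"
  let ?z = "\<lambda>p. inf \<bar>ob_apply (case p of (a, b) \<Rightarrow> ob_compose (F a) (G b)) x - ob_apply (ob_compose S T) x\<bar> y"
  let ?e = "\<bar>x\<bar>"
  let ?g = "ob_apply \<bar>S\<bar> \<bar>x\<bar>"
  assume y: "0 \<le> y" and w: "0 \<le> w" and below: "below_limsup (A \<times> B) ?r ?z w"
  note AB = directed_on_product_order[OF A B]
  obtain p0 where p0: "p0 \<in> A \<times> B" using directed_onD(1)[OF AB] by blast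
  have bound: "dominates (A \<times> B) ?r ?z y" by (rule dominatesI[OF p0]) simp
  have g0: "0 \<le> ?g" by (intro ob_apply_nonneg) simp_all
  have S_lim: "uo_tendsto A r (\<lambda>a. ob_apply (F a) u) (ob_apply S u)" for u
    using F_lim by (simp add: SUO_tendsto_def)
  have T_lim: "uo_tendsto B s (\<lambda>b. ob_apply (G b) u) (ob_apply T u)" for u
    using G_lim by (simp add: SUO_tendsto_def)
  let ?k = "\<lambda>a. inf \<bar>ob_apply (F a) (ob_apply T x) - ob_apply S (ob_apply T x)\<bar> y"
  let ?m = "\<lambda>a. inf \<bar>ob_apply (F a) ?e - ob_apply S ?e\<bar> y"
  have small: "real N *\<^sub>R inf ?e w \<le> ?g" if N: "0 < N" for N :: nat
  proof -
    define c where "c = inverse (real N)"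
    have c: "0 \<le> c" "c \<le> 1" "real N * c = 1" using N by (simp_all add: c_def field_simps)
    let ?t = "\<lambda>b. \<bar>ob_apply (G b) x - ob_apply T x\<bar>"
    have step: "inf ?e w \<le> c *\<^sub>R ?g + real N *\<^sub>R h"
      if h: "dominates B s (\<lambda>b. inf (?t b) (c *\<^sub>R ?e)) h" for h
    proof -
      have ce: "0 \<le> c *\<^sub>R ?e" using c by (simp add: scaleR_nonneg_nonneg)
      obtain b0 where b0: "b0 \<in> B" "\<And>b. (b0, b) \<in> s \<Longrightarrow> inf (?t b) (c *\<^sub>R ?e) \<le> h"
        by (rule dominatesE[OF h]) blast
      have "0 \<le> inf (?t b0) (c *\<^sub>R ?e)" using ce by simp
      also have "\<dots> \<le> h" using b0 directed_onD(2)[OF B] by blast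
      finally have h0: "0 \<le> real N *\<^sub>R h" by (simp add: scaleR_nonneg_nonneg)
      define q where "q = pprt (c *\<^sub>R ?e - h)"
      \<comment> \<open>\<open>q\<close> is rescaled so that \<open>v\<close> exhausts \<open>\<bar>x\<bar>\<close> up to a multiple of \<open>h\<close>.\<close>
      define v where "v = real N *\<^sub>R q"
      have v0: "0 \<le> v" by (simp add: v_def q_def scaleR_nonneg_nonneg)
      have "c *\<^sub>R ?e \<le> q + h" unfolding q_def by (rule le_pprt_diff_add)
      then have "real N *\<^sub>R c *\<^sub>R ?e \<le> real N *\<^sub>R (q + h)" by (rule scaleR_left_mono) simp
      then have e_le: "?e \<le> v + real N *\<^sub>R h" using c(3) by (simp add: v_def scaleR_add_right)
      have est: "inf v (?z (a, b)) \<le> c *\<^sub>R ?g + ?k a + ?m a"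
        if a: "a \<in> A" and b: "b \<in> B" "(b0, b) \<in> s" for a b
      proof -
        let ?p = "pprt (?t b - c *\<^sub>R ?e)"
        let ?n = "\<bar>ob_apply (F a) ?p\<bar>"
        let ?M = "\<bar>ob_apply (F a) ?e - ob_apply S ?e\<bar>"
        let ?K = "\<bar>ob_apply (F a) (ob_apply T x) - ob_apply S (ob_apply T x)\<bar>"
        have q_le: "q \<le> pprt (- (?t b - c *\<^sub>R ?e))"
        proof -
          have "c *\<^sub>R ?e - h \<le> c *\<^sub>R ?e - inf (?t b) (c *\<^sub>R ?e)"
            using b0(2)[OF b(2)] by (rule diff_left_mono)
          also have "\<dots> = pprt (c *\<^sub>R ?e - ?t b)"
            using inf_add_pprt_diff[of "?t b" "c *\<^sub>R ?e"] by (metis add_diff_cancel_left')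
          finally show ?thesis by (simp add: q_def pprt_def)
        qed
        have "disjoint ?p q"
          by (rule disjoint_mono[OF disjoint_pprt_pprt_uminus[of "?t b - c *\<^sub>R ?e"]])
            (use q_le in \<open>simp_all add: q_def\<close>)
        then have "disjoint v (ob_apply (F a) ?p)"
          unfolding v_def by (intro disjoint_scaleR disjoint_sym[OF Orth_disjoint[OF F[OF a]]])
        then have nv: "inf ?n v = 0" using v0 by (simp add: disjoint_def inf_commute)
        have D: "F a - S \<in> Orth" using F[OF a] S by (rule Orth_diff)
        have tri: "\<bar>F a\<bar> \<le> \<bar>S\<bar> + \<bar>F a - S\<bar>"
          using abs_triangle_ineq[of S "F a - S"] by simp
        have "ob_apply \<bar>F a\<bar> (c *\<^sub>R ?e) \<le> c *\<^sub>R (?g + ?M)"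
        proof -
          have "ob_apply \<bar>F a\<bar> ?e \<le> ?g + ob_apply \<bar>F a - S\<bar> ?e"
            using ob_apply_leD[OF tri, of ?e] by (simp add: plus_ob_operator.rep_eq)
          also have "ob_apply \<bar>F a - S\<bar> ?e = ?M"
            by (simp add: Orth_abs_apply[OF D] minus_ob_operator.rep_eq)
          finally show ?thesis using c(1) by (simp only: ob_apply_scaleR scaleR_left_mono)
        qed
        moreover have "c *\<^sub>R ?M \<le> ?M" using scaleR_right_mono[OF c(2), of ?M] by simp
        ultimately have 1: "ob_apply \<bar>F a\<bar> (c *\<^sub>R ?e) \<le> c *\<^sub>R ?g + ?M"
          unfolding scaleR_add_right by (meson add_left_mono order_trans)
        have "?t b \<le> c *\<^sub>R ?e + ?p"
          using le_pprt_diff_add[of "?t b" "c *\<^sub>R ?e"] by (simp only: add.commute)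
        then have "ob_apply \<bar>F a\<bar> (?t b) \<le> ob_apply \<bar>F a\<bar> (c *\<^sub>R ?e) + ob_apply \<bar>F a\<bar> ?p"
          unfolding ob_apply_add[symmetric] by (rule ob_apply_mono[OF abs_ge_zero])
        also have "ob_apply \<bar>F a\<bar> ?p = ?n" by (rule Orth_abs_apply[OF F[OF a]]) simp
        finally have 2: "ob_apply \<bar>F a\<bar> (?t b) \<le> c *\<^sub>R ?g + ?M + ?n"
          using 1 by (meson add_right_mono order_trans)
        have "ob_apply (F a) (ob_apply (G b) x) - ob_apply S (ob_apply T x) =
            ob_apply (F a) (ob_apply (G b) x - ob_apply T x) +
            (ob_apply (F a) (ob_apply T x) - ob_apply S (ob_apply T x))"
          by (simp add: ob_apply_diff)
        then have "\<bar>ob_apply (F a) (ob_apply (G b) x) - ob_apply S (ob_apply T x)\<bar> \<le>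
            \<bar>ob_apply (F a) (ob_apply (G b) x - ob_apply T x)\<bar> + ?K"
          by (metis abs_triangle_ineq)
        also have "\<dots> \<le> c *\<^sub>R ?g + ?M + ?n + ?K"
          using order_trans[OF abs_ob_apply_le 2] by (rule add_right_mono)
        also have "\<dots> = c *\<^sub>R ?g + ?K + ?M + ?n" by (simp add: algebra_simps)
        finally have "inf v (?z (a, b)) \<le> inf v (inf (c *\<^sub>R ?g + ?K + ?M + ?n) y)"
          by (intro inf_mono order_refl) (simp add: ob_compose.rep_eq)
        also have "\<dots> \<le> c *\<^sub>R ?g + ?k a + ?m a"
          using nv c(1) g0 v0 y by (intro inf_le_of_disjoint_part) (simp_all add: scaleR_nonneg_nonneg)
        finally show ?thesis .
      qed
      have "inf v w \<le> c *\<^sub>R ?g"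
      proof (rule uo_tendsto_limit_le[OF S_lim[of ?e] y])
        fix h2 assume "dominates A r ?m h2"
        then obtain a2 where a2: "a2 \<in> A" "\<And>a. (a2, a) \<in> r \<Longrightarrow> ?m a \<le> h2"
          by (rule dominatesE) blast
        show "inf v w \<le> c *\<^sub>R ?g + h2"
        proof (rule uo_tendsto_limit_le[OF S_lim[of "ob_apply T x"] y])
          fix h1 assume "dominates A r ?k h1"
          then obtain a1 where a1: "a1 \<in> A" "\<And>a. (a1, a) \<in> r \<Longrightarrow> ?k a \<le> h1"
            by (rule dominatesE) blast
          obtain a0 where a0: "a0 \<in> A" "(a1, a0) \<in> r" "(a2, a0) \<in> r"
            using directed_onD(5)[OF A a1(1) a2(1)] by blast
          show "inf v w \<le> c *\<^sub>R ?g + h2 + h1"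
          proof (rule below_limsup_inf[OF AB below bound], rule dominatesI[of "(a0, b0)"])
            show "(a0, b0) \<in> A \<times> B" using a0 b0 by simp
            fix p assume p: "((a0, b0), p) \<in> ?r"
            obtain a b where ab: "p = (a, b)" "(a0, a) \<in> r" "(b0, b) \<in> s"
              using p by (cases p) (simp add: product_order_def)
            have "?k a \<le> h1" "?m a \<le> h2"
              using a1(2) a2(2) directed_onD(3)[OF A _ ab(2)] a0 by blast+
            moreover have "inf v (?z (a, b)) \<le> c *\<^sub>R ?g + ?k a + ?m a"
              using directed_onD(4)[OF A ab(2)] directed_onD(4)[OF B ab(3)] ab(3) by (intro est) simp_all
            ultimately have "inf v (?z (a, b)) \<le> c *\<^sub>R ?g + h1 + h2"
              by (meson add_mono order_refl order_trans)
            then show "inf v (?z p) \<le> c *\<^sub>R ?g + h2 + h1" by (simp only: ab(1) ac_simps)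
          qed
        qed
      qed
      moreover have "inf ?e w \<le> inf v w + real N *\<^sub>R h"
      proof -
        have "inf ?e w \<le> inf (v + real N *\<^sub>R h) w" using e_le by (rule inf_mono) simp
        also have "\<dots> \<le> inf v w + inf (real N *\<^sub>R h) w" using v0 h0 w by (rule inf_add_le)
        also have "\<dots> \<le> inf v w + real N *\<^sub>R h" by (intro add_left_mono) simp
        finally show ?thesis .
      qed
      ultimately show ?thesis by (meson add_right_mono order_trans)
    qed
    \<comment> \<open>Multiplying by \<open>c\<close> turns the error \<open>N h\<close> into \<open>h\<close>.\<close>
    have "c *\<^sub>R inf ?e w \<le> c *\<^sub>R c *\<^sub>R ?g"
    proof (rule uo_tendsto_limit_le[OF T_lim[of x], of "c *\<^sub>R ?e"])
      show "0 \<le> c *\<^sub>R ?e" using c by (simp add: scaleR_nonneg_nonneg)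
      fix h assume "dominates B s (\<lambda>b. inf (?t b) (c *\<^sub>R ?e)) h"
      then have "c *\<^sub>R inf ?e w \<le> c *\<^sub>R (c *\<^sub>R ?g + real N *\<^sub>R h)"
        using c(1) by (intro scaleR_left_mono step)
      also have "\<dots> = c *\<^sub>R c *\<^sub>R ?g + h"
        using c(3) by (simp add: scaleR_add_right mult.commute)
      finally show "c *\<^sub>R inf ?e w \<le> c *\<^sub>R c *\<^sub>R ?g + h" .
    qed
    then have "(real N * real N) *\<^sub>R c *\<^sub>R inf ?e w \<le> (real N * real N) *\<^sub>R c *\<^sub>R c *\<^sub>R ?g"
      by (rule scaleR_left_mono) simp
    moreover have "real N * real N * c = real N" "real N * real N * c * c = 1"
      using N by (simp_all add: c_def divide_simps)
    ultimately show ?thesis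
      by (simp only: scaleR_scaleR scaleR_one mult.assoc[symmetric])
  qed
  have "inf ?e w \<le> 0"
  proof (rule dedekind_complete_archimedean)
    fix N :: nat
    show "real N *\<^sub>R inf ?e w \<le> ?g" using small[of N] g0 by (cases "N = 0") simp_all
  qed
  then show "w = 0"
  proof (rule below_limsup_disjoint_eq_0[OF AB below w bound])
    show "0 \<le> ?z p" for p using y by simp
    fix p v assume p: "p \<in> A \<times> B" and v: "disjoint x v"
    obtain a b where ab: "p = (a, b)" "a \<in> A" "b \<in> B" using p by blast
    have "disjoint (ob_apply (ob_compose (F a) (G b)) x - ob_apply (ob_compose S T) x) v"
      by (intro disjoint_diff Orth_disjoint[OF _ v] Orth_compose F G S T ab)
    then show "disjoint (?z p) v" by (rule disjoint_mono) (use y in \<open>simp_all add: ab(1)\<close>)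
  qed
qed

lemma Orth_limit:
  fixes F :: "'i \<Rightarrow> 'a::dedekind_complete_vector_lattice ob_operator"
  assumes c: "c \<in> {uo_tendsto, SUO_tendsto}" and A: "directed_on A r"
    and F: "\<And>a. a \<in> A \<Longrightarrow> F a \<in> Orth" and lim: "c A r F T"
  shows "T \<in> Orth" and "SUO_tendsto A r F T"
proof -
  consider "uo_tendsto A r F T" | "SUO_tendsto A r F T" using c lim by auto
  then have "T \<in> Orth \<and> SUO_tendsto A r F T"
  proof cases
    case 1
    have "T \<in> Orth" by (rule Orth_uo_closed[OF A _ 1]) (rule F)
    moreover from this have "SUO_tendsto A r F T" by (rule Orth_uo_imp_SUO[OF A _ _ 1, rotated]) (rule F)
    ultimately show ?thesis by blast
  next
    case 2
    have "T \<in> Orth" by (rule Orth_SUO_closed[OF A _ 2]) (rule F)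
    then show ?thesis using 2 by blast
  qed
  then show "T \<in> Orth" "SUO_tendsto A r F T" by blast+
qed

theorem proposition5p8:
  fixes A :: "'i set" and r :: "'i rel" and B :: "'j set" and s :: "'j rel"
    and Sn :: "'i \<Rightarrow> 'a::dedekind_complete_vector_lattice ob_operator"
    and Tn :: "'j \<Rightarrow> 'a ob_operator"
    and S T :: "'a ob_operator"
    and c1 :: "'i set \<Rightarrow> 'i rel \<Rightarrow> ('i \<Rightarrow> 'a ob_operator) \<Rightarrow> 'a ob_operator \<Rightarrow> bool"
    and c2 :: "'j set \<Rightarrow> 'j rel \<Rightarrow> ('j \<Rightarrow> 'a ob_operator) \<Rightarrow> 'a ob_operator \<Rightarrow> bool"
    and c3 :: "('i \<times> 'j) set \<Rightarrow> ('i \<times> 'j) rel \<Rightarrow> ('i \<times> 'j \<Rightarrow> 'a ob_operator) \<Rightarrow>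
                 'a ob_operator \<Rightarrow> bool"
  assumes c1: "c1 \<in> {uo_tendsto, SUO_tendsto}"
    and c2: "c2 \<in> {uo_tendsto, SUO_tendsto}"
    and c3: "c3 \<in> {uo_tendsto, SUO_tendsto}"
    and A: "directed_on A r"
    and S_Orth: "\<And>a. a \<in> A \<Longrightarrow> Sn a \<in> Orth"
    and S_lim: "c1 A r Sn S"
    and B: "directed_on B s"
    and T_Orth: "\<And>b. b \<in> B \<Longrightarrow> Tn b \<in> Orth"
    and T_lim: "c2 B s Tn T"
  shows "S \<in> Orth \<and> T \<in> Orth \<and>
    c3 (A \<times> B) (product_order r s) (\<lambda>(a, b). ob_compose (Sn a) (Tn b)) (ob_compose S T)"
proof -
  note S = Orth_limit[OF c1 A S_Orth S_lim] and T = Orth_limit[OF c2 B T_Orth T_lim]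
  let ?F = "\<lambda>(a, b). ob_compose (Sn a) (Tn b)"
  note AB = directed_on_product_order[OF A B]
  have SUO: "SUO_tendsto (A \<times> B) (product_order r s) ?F (ob_compose S T)"
    by (rule Orth_SUO_compose[OF A S_Orth S B T_Orth T])
  have "?F p \<in> Orth" if "p \<in> A \<times> B" for p
    using that S_Orth T_Orth by (auto intro: Orth_compose)
  then have "uo_tendsto (A \<times> B) (product_order r s) ?F (ob_compose S T)"
    using Orth_SUO_imp_uo[OF AB _ Orth_compose[OF S(1) T(1)] SUO] by blast
  then show ?thesis using S(1) T(1) SUO c3 by auto
qed

end
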